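(* Let $m,n,M,N$ be nonnegative integers such that $M$, $N$ and $m-n$ are even. Let $R^0=(u_1,\dots,u_m)$ (resp. $S^0=(v_1,\dots,v_n)$) be an $m$-vertex (resp. $n$-vertex) in an acyclic digraph $D$. Let $R=\{U_1<\cdots<U_M\}$ (resp. $S=\{V_1<\cdots<V_N\}$) be a totally ordered subset of vertices of $D$ which is disjoint from $R^0$ (resp. $S^0$). Assume that $R^0\uplus R$ is $D$-compatible with $S^0\uplus S$. Let $A=(a_{U_iU_j})$ (resp. $B=(b_{V_iV_j})$) be a nonsingular skew-symmetric matrix with rows and columns indexed by the vertices of $R$ (resp. $S$), and let $z$ be an indeterminate. Then $$\sum_{\substack{\max(m,n)\le r\le\min(m+M,n+N)\\ r-\max(m,n)\text{ even}}}z^r\sum_{I\in\binom R{r-m}}\sum_{J\in\binom S{r-n}}\operatorname{Pf}(A^I_I)\operatorname{Pf}(B^J_J)\,F^0(R^0\uplus I,S^0\uplus J)$$ $$=\operatorname{Pf}(A)\operatorname{Pf}(B)\operatorname{Pf}\begin{pmatrix}O_m&O_{m,M}&zH(R^0,S)J_N&zH(R^0,S^0)J_n\\O_{M,m}&\frac1{\operatorname{Pf}(A)}\widehat A&zH(R,S)J_N&zH(R,S^0)J_n\\-zJ_N\,{}^tH(R^0,S)&-zJ_N\,{}^tH(R,S)&\frac1{\operatorname{Pf}(B)}J_N\,{}^t\widehat B\,J_N&O_{N,n}\\-zJ_n\,{}^tH(R^0,S^0)&-zJ_n\,{}^tH(R,S^0)&O_{n,N}&O_n\end{pmatrix}.$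$
   Context: $D=(V,E)$ is an acyclic digraph without multiple edges, with only finitely many directed paths between any two vertices. For vertices $u,v$, $\mathcal P(u,v)$ is the set of directed paths from $u$ to $v$. Each edge $e$ carries a commutative indeterminate $x_e$ as weight; the weight of a path is the product of the weights of its edges, and $h(u,v)=\sum_{P\in\mathcal P(u,v)}\operatorname{wt}(P)$. An $r$-vertex is an $r$-tuple of vertices. For $r$-vertices $\boldsymbol u,\boldsymbol v$, an $r$-path from $\boldsymbol u$ to $\boldsymbol v$ is $(P_1,\dots,P_r)$ with $P_i\in\mathcal P(u_i,v_i)$; its weight is the product of the weights of the $P_i$; it is non-intersecting if $P_i$ and $P_j$ share no vertex for all $i\ne j$. $F^0(\boldsymbol u,\boldsymbol v)$ is the sum of the weights of all non-intersecting $r$-paths from $\boldsymbol u$ to $\boldsymbol v$ (equal to $1$ for $r=0$). A finite totally ordered set of vertices is regarded as the tuple of its elements in increasing order, and $X\uplus Y$ denotes the tuple $X$ followed by the tuple $Y$. A tuple $(w_1,\dots,w_p)$ is $D$-compatible with $(w'_1,\dots,w'_q)$ if every path in $\mathcal P(w_i,w'_l)$ intersects (shares a vertex with) every path in $\mathcal P(w_j,w'_k)$ whenever $i<j$ and $k<l$. For tuples $X=(x_i)$, $Y=(y_j)$ of vertices, $H(X,Y)=(h(x_i,y_j))_{i,j}$. $\binom Rk$ is the set of $k$-element subsets of $R$. $A^I_I$ is the submatrix of $A$ with rows and columns indexed by $I$. $\operatorname{Pf}$ is the Pfaffian of a skew-symmetric matrix of even size, normalized by $\operatorname{Pf}\begin{pmatrix}0&a\\-a&0\end{pmatrix}=a$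 (empty Pfaffian $=1$). The copfaffian matrix $\widehat A$ of a skew-symmetric $A$ of even size is the skew-symmetric matrix with $(i,j)$ entry, for $i<j$, equal to $(-1)^{i+j-1}$ times the Pfaffian of $A$ with rows and columns $i,j$ removed. $J_N$ is the $N\times N$ matrix with ones on the antidiagonal and zeros elsewhere, $O_{p,q}$ the $p\times q$ zero matrix, $O_p=O_{p,p}$, ${}^tX$ the transpose. *)

theory Defs
  imports
    "Graph_Theory.Graph_Theory"
    "Jordan_Normal_Form.Determinant"
    "Jordan_Normal_Form.DL_Submatrix"
begin

text \<open>
  Digraphs are those of Graph_Theory (possibly infinite); a directed path is an apath, i.e. a
  list of arcs, and the trivial path at a vertex is the empty list. Tuples of vertices are lists.
  The indeterminates attached to the arcs are modelled by an arbitrary assignment x of arcs to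
  elements of a commutative ring; the field generated by independent indeterminates is the
  universal instance.
\<close>

definition acyclic_digraph :: "('v, 'e) pre_digraph \<Rightarrow> bool" where
  "acyclic_digraph D \<longleftrightarrow> nomulti_digraph D \<and> \<not> (\<exists>p. pre_digraph.cycle D p)"

definition paths :: "('v, 'e) pre_digraph \<Rightarrow> 'v \<Rightarrow> 'v \<Rightarrow> 'e list set" where
  "paths D u v = {p. pre_digraph.apath D u p v}"

definition finitely_many_paths :: "('v, 'e) pre_digraph \<Rightarrow> bool" where
  "finitely_many_paths D \<longleftrightarrow> (\<forall>u \<in> verts D. \<forall>v \<in> verts D. finite (paths D u v))"

text \<open>A trivial path is the empty list of arcs, so its vertices depend on the start vertex too.\<close>

definition path_verts :: "('v, 'e) pre_digraph \<Rightarrow> 'v \<Rightarrow> 'e list \<Rightarrow> 'v set" where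
  "path_verts D u p = set (pre_digraph.awalk_verts D u p)"

definition path_wt :: "('e \<Rightarrow> 'a::comm_ring_1) \<Rightarrow> 'e list \<Rightarrow> 'a" where
  "path_wt x p = prod_list (map x p)"

definition h :: "('v, 'e) pre_digraph \<Rightarrow> ('e \<Rightarrow> 'a::comm_ring_1) \<Rightarrow> 'v \<Rightarrow> 'v \<Rightarrow> 'a" where
  "h D x u v = (\<Sum>p \<in> paths D u v. path_wt x p)"

definition nonintersecting_rpaths ::
  "('v, 'e) pre_digraph \<Rightarrow> 'v list \<Rightarrow> 'v list \<Rightarrow> 'e list list set" where
  "nonintersecting_rpaths D us vs =
    {ps. length us = length vs \<and> length ps = length us \<and>
         (\<forall>i < length us. ps ! i \<in> paths D (us ! i) (vs ! i)) \<and>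
         (\<forall>i < length us. \<forall>j < length us. i \<noteq> j \<longrightarrow>
            path_verts D (us ! i) (ps ! i) \<inter> path_verts D (us ! j) (ps ! j) = {})}"

definition F0 ::
  "('v, 'e) pre_digraph \<Rightarrow> ('e \<Rightarrow> 'a::comm_ring_1) \<Rightarrow> 'v list \<Rightarrow> 'v list \<Rightarrow> 'a" where
  "F0 D x us vs = (\<Sum>ps \<in> nonintersecting_rpaths D us vs. \<Prod>p\<leftarrow>ps. path_wt x p)"

definition D_compatible :: "('v, 'e) pre_digraph \<Rightarrow> 'v list \<Rightarrow> 'v list \<Rightarrow> bool" where
  "D_compatible D ws ws' \<longleftrightarrow>
    (\<forall>i j k l. i < j \<longrightarrow> j < length ws \<longrightarrow> k < l \<longrightarrow> l < length ws' \<longrightarrow>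
      (\<forall>p \<in> paths D (ws ! i) (ws' ! l). \<forall>q \<in> paths D (ws ! j) (ws' ! k).
         path_verts D (ws ! i) p \<inter> path_verts D (ws ! j) q \<noteq> {}))"

text \<open>
  A finite totally ordered set of vertices is a distinct list; the tuple of a subset I of it
  lists the elements of I in the induced order.
\<close>

definition subtuple :: "'v list \<Rightarrow> 'v set \<Rightarrow> 'v list" where
  "subtuple Us I = filter (\<lambda>w. w \<in> I) Us"

text \<open>
  The matrix of a function of two vertices with respect to tuples of row and column indices.
  Both H(X,Y) and the submatrices of a matrix indexed by vertices are of this form.
\<close>

definition vmat :: "('v \<Rightarrow> 'w \<Rightarrow> 'a) \<Rightarrow> 'v list \<Rightarrow> 'w list \<Rightarrow> 'a mat" where
  "vmat f X Y = mat (length X) (length Y) (\<lambda>(i, j). f (X ! i) (Y ! j))"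

definition H ::
  "('v, 'e) pre_digraph \<Rightarrow> ('e \<Rightarrow> 'a::comm_ring_1) \<Rightarrow> 'v list \<Rightarrow> 'v list \<Rightarrow> 'a mat" where
  "H D x X Y = vmat (h D x) X Y"

text \<open>The condition on the diagonal is redundant unless the characteristic is two.\<close>

definition skew_symmetric_mat :: "'a::comm_ring_1 mat \<Rightarrow> bool" where
  "skew_symmetric_mat A \<longleftrightarrow>
    square_mat A \<and> transpose_mat A = - A \<and> (\<forall>i < dim_row A. A $$ (i, i) = 0)"

text \<open>
  The permutations summed over represent the perfect matchings
  of 0, ..., 2n-1 uniquely. Only meant for matrices of even size.
\<close>

definition Pf :: "'a::comm_ring_1 mat \<Rightarrow> 'a" where
  "Pf A = (let n = dim_row A div 2 in
    \<Sum>\<sigma> | \<sigma> permutes {..<2 * n} \<and> (\<forall>i < n. \<sigma> (2 * i) < \<sigma> (2 * i + 1)) \<and>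
            (\<forall>i < n. \<forall>j < n. i < j \<longrightarrow> \<sigma> (2 * i) < \<sigma> (2 * j)).
      of_int (sign \<sigma>) * (\<Prod>i < n. A $$ (\<sigma> (2 * i), \<sigma> (2 * i + 1))))"

text \<open>
  With 0-based indices i and j, the sign for i < j, which is
  (-1) to the power i + j - 1 for 1-based indices, has exponent i + j + 1.
\<close>

definition copfaffian :: "'a::comm_ring_1 mat \<Rightarrow> 'a mat" where
  "copfaffian A = mat (dim_row A) (dim_row A) (\<lambda>(i, j).
     let c = (- 1) ^ (i + j + 1) * Pf (submatrix A (- {i, j}) (- {i, j})) in
     if i < j then c else if j < i then - c else 0)"

definition antidiag_mat :: "nat \<Rightarrow> 'a::comm_ring_1 mat" where
  "antidiag_mat k = mat k k (\<lambda>(i, j). if i + j + 1 = k then 1 else 0)"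

end

theory Submission
  imports Defs "HOL-Library.Sublist"
begin

text \<open>
  Up to sign, the normalised copfaffian matrices are the inverses of \<open>A\<close> and \<open>B\<close>. The block matrix is the
  sum of a block diagonal part, made of these inverses, and an off-diagonal part. The Pfaffian of a
  sum of skew-symmetric matrices is the exterior product of the two families of sub-Pfaffians. In
  the resulting expansion Jacobi's identity replaces the complementary Pfaffians of the inverses by
  \<open>Pf (A I I) / Pf A\<close> and \<open>Pf (B K K) / Pf B\<close>, and the off-diagonal part contributes the determinants of
  \<open>H (R0 @ I) (S0 @ K)\<close>. These count non-intersecting paths by the lemma of Lindstroem, Gessel
  and Viennot, since D-compatibility excludes all non-identical permutations.
\<close>

section \<open>Alternating forms and list Pfaffians\<close>

text \<open>For an alternating \<open>a\<close>, \<open>pf a\<close> is the exponential of the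
  2-form with coefficients \<open>a\<close>: \<open>contr_pf\<close> is its differential equation,
  and \<open>pf_add\<close> says that the exponential of a sum is the product of the exponentials.
  Arguing through contractions avoids division and factorials, so that characteristic two needs no
  special treatment. The sign left open in the overview is a minus: the copfaffian matrix divided by
  the Pfaffian is minus the inverse. For size two with upper right entry c, the copfaffian matrix
  has upper right entry 1, whereas the inverse has -1/c there. This is the reason for the right-hand
  side \<open>- of_bool (w = y)\<close> in every hypothesis relating \<open>p\<close> to
  \<open>a\<close>. With this normalisation Jacobi's identity carries the shuffle sign of the index
  set and no further power of -1. The exterior product carries the same shuffle sign, so the two
  cancel and the final sum over subsets has no signs.\<close>

text \<open>
  A form is a function on lists of vectors. The exterior product is the signed sum over all ways to
  split the argument list into two subsequences; the recursion below expresses that contraction with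
  a vector is an antiderivation, so that identities of forms follow by induction on the list.
\<close>

definition contr :: "'i \<Rightarrow> ('i list \<Rightarrow> 'a) \<Rightarrow> 'i list \<Rightarrow> 'a" where
  "contr x f = (\<lambda>l. f (x # l))"

text \<open>The sign for moving a vector past all arguments of \<open>f\<close>. A function on lists
  need not have one degree, so the degree is read off from the argument list.\<close>

definition twist :: "('i list \<Rightarrow> 'a::comm_ring_1) \<Rightarrow> 'i list \<Rightarrow> 'a" where
  "twist f = (\<lambda>l. (-1) ^ length l * f l)"

fun wedge :: "('i list \<Rightarrow> 'a::comm_ring_1) \<Rightarrow> ('i list \<Rightarrow> 'a) \<Rightarrow> 'i list \<Rightarrow> 'a" where
  "wedge f g [] = f [] * g []"
| "wedge f g (x # xs) = wedge (contr x f) g xs + wedge (twist f) (contr x g) xs"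

definition one_form :: "('i \<Rightarrow> 'a::comm_ring_1) \<Rightarrow> 'i list \<Rightarrow> 'a" where
  "one_form \<alpha> = (\<lambda>l. case l of [x] \<Rightarrow> \<alpha> x | _ \<Rightarrow> 0)"

definition unit_form :: "'i list \<Rightarrow> 'a::comm_ring_1" where
  "unit_form = (\<lambda>l. if l = [] then 1 else 0)"

lemma twist_twist [simp]: "twist (twist f) = f"
  by (auto simp: twist_def fun_eq_iff mult.assoc[symmetric] power_mult_distrib[symmetric])

lemma contr_twist: "contr x (twist f) = (\<lambda>l. - twist (contr x f) l)"
  by (auto simp: twist_def contr_def)

lemma contr_one_form: "contr x (one_form \<alpha>) = (\<lambda>l. \<alpha> x * unit_form l)"
  by (auto simp: contr_def one_form_def unit_form_def fun_eq_iff split: list.split)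

lemma unit_form_Nil [simp]: "unit_form [] = 1"
  by (simp add: unit_form_def)

lemma contr_unit_form [simp]: "contr x unit_form = (\<lambda>l. 0)"
  by (auto simp: contr_def unit_form_def)

lemma twist_unit_form [simp]: "twist unit_form = unit_form"
  by (auto simp: twist_def unit_form_def)

lemma twist_one_form: "twist (one_form \<alpha>) = (\<lambda>l. - one_form \<alpha> l)"
  by (auto simp: twist_def one_form_def fun_eq_iff split: list.split)

lemma contr_wedge:
  "contr x (wedge f g) = (\<lambda>l. wedge (contr x f) g l + wedge (twist f) (contr x g) l)"
  by (auto simp: contr_def)

text \<open>The product evaluates its factors only on sublists of \<open>xs\<close>. The bound on
  the length serves forms known to alternate only up to some length; the bound on the entries serves
  identities that hold only over a fixed set of indices.\<close>

lemma wedge_cong: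
  assumes "\<And>l. length l \<le> length xs \<Longrightarrow> set l \<subseteq> set xs \<Longrightarrow> f l = f' l"
    and "\<And>l. length l \<le> length xs \<Longrightarrow> set l \<subseteq> set xs \<Longrightarrow> g l = g' l"
  shows "wedge f g xs = wedge f' g' xs"
  using assms
proof (induction xs arbitrary: f g f' g')
  case (Cons x xs)
  have "wedge (contr x f) g xs = wedge (contr x f') g' xs"
    by (rule Cons.IH) (auto simp: contr_def intro!: Cons.prems)
  moreover have "wedge (twist f) (contr x g) xs = wedge (twist f') (contr x g') xs"
    by (rule Cons.IH)
      (auto simp: contr_def twist_def intro!: Cons.prems arg_cong2[where f="(*)"])
  ultimately show ?case by simp
qed auto

lemma wedge_add_left: "wedge (\<lambda>l. f l + f' l) g xs = wedge f g xs + wedge f' g xs"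
proof (induction xs arbitrary: f f' g)
  case (Cons x xs)
  have "contr x (\<lambda>l. f l + f' l) = (\<lambda>l. contr x f l + contr x f' l)"
    "twist (\<lambda>l. f l + f' l) = (\<lambda>l. twist f l + twist f' l)"
    by (auto simp: contr_def twist_def algebra_simps)
  then show ?case using Cons by simp
qed (auto simp: algebra_simps)

lemma wedge_add_right: "wedge f (\<lambda>l. g l + g' l) xs = wedge f g xs + wedge f g' xs"
proof (induction xs arbitrary: f g' g)
  case (Cons x xs)
  have "contr x (\<lambda>l. g l + g' l) = (\<lambda>l. contr x g l + contr x g' l)"
    by (auto simp: contr_def)
  then show ?case using Cons by simp
qed (auto simp: algebra_simps)

lemma wedge_scale_left: "wedge (\<lambda>l. c * f l) g xs = c * wedge f g xs"
proof (induction xs arbitrary: f g)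
  case (Cons x xs)
  have "contr x (\<lambda>l. c * f l) = (\<lambda>l. c * contr x f l)"
    "twist (\<lambda>l. c * f l) = (\<lambda>l. c * twist f l)"
    by (auto simp: contr_def twist_def)
  then show ?case using Cons by (simp add: algebra_simps)
qed (auto simp: algebra_simps)

lemma wedge_scale_right: "wedge f (\<lambda>l. c * g l) xs = c * wedge f g xs"
proof (induction xs arbitrary: f g)
  case (Cons x xs)
  have "contr x (\<lambda>l. c * g l) = (\<lambda>l. c * contr x g l)"
    by (auto simp: contr_def)
  then show ?case using Cons by (simp add: algebra_simps)
qed (auto simp: algebra_simps)

lemma wedge_zero_left [simp]: "wedge (\<lambda>l. 0) g xs = 0"
  using wedge_scale_left[of 0 "\<lambda>l. 0" g xs] by simp

lemma wedge_zero_right [simp]: "wedge f (\<lambda>l. 0) xs = 0"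
  using wedge_scale_right[of f 0 "\<lambda>l. 0" xs] by simp

lemma wedge_minus_left: "wedge (\<lambda>l. - f l) g xs = - wedge f g xs"
  using wedge_scale_left[of "-1" f g xs] by simp

lemma wedge_minus_right: "wedge f (\<lambda>l. - g l) xs = - wedge f g xs"
  using wedge_scale_right[of f "-1" g xs] by simp

lemma wedge_sum_left: "wedge (\<lambda>l. \<Sum>i\<in>A. f i l) g xs = (\<Sum>i\<in>A. wedge (f i) g xs)"
  by (induction A rule: infinite_finite_induct) (auto simp: wedge_add_left)

lemma twist_wedge: "twist (wedge f g) = wedge (twist f) (twist g)"
proof -
  have "twist (wedge f g) xs = wedge (twist f) (twist g) xs" for xs
  proof (induction xs arbitrary: f g)
    case Nil
    then show ?case by (simp add: twist_def)
  next
    case (Cons x xs)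
    have "twist (wedge f g) (x # xs) = - (twist (contr x (wedge f g)) xs)"
      by (simp add: twist_def contr_def)
    also have "twist (contr x (wedge f g)) xs
      = twist (wedge (contr x f) g) xs + twist (wedge (twist f) (contr x g)) xs"
      by (simp add: contr_wedge) (simp add: twist_def algebra_simps)
    finally show ?case using Cons
      by (simp add: contr_twist wedge_minus_left wedge_minus_right)
  qed
  then show ?thesis by (rule ext)
qed

lemma wedge_assoc: "wedge (wedge f g) k = wedge f (wedge g k)"
proof
  fix xs
  show "wedge (wedge f g) k xs = wedge f (wedge g k) xs"
    by (induction xs arbitrary: f g k)
      (simp_all add: contr_wedge wedge_add_left wedge_add_right twist_wedge algebra_simps)
qed

lemma wedge_unit_left [simp]: "wedge unit_form g = g"
proof
  fix xs
  show "wedge unit_form g xs = g xs"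
    by (induction xs arbitrary: g) (simp_all, simp_all add: contr_def)
qed

lemma wedge_unit_right [simp]: "wedge f unit_form = f"
proof
  fix xs
  show "wedge f unit_form xs = f xs"
    by (induction xs arbitrary: f) (simp_all, simp_all add: contr_def)
qed

text \<open>A one-form moved past a part of degree k costs (-1)^k; \<open>twist\<close> does this in
  all degrees at once.\<close>

lemma wedge_one_form_commute: "wedge (one_form \<alpha>) g = wedge (twist g) (one_form \<alpha>)"
proof
  fix xs
  show "wedge (one_form \<alpha>) g xs = wedge (twist g) (one_form \<alpha>) xs"
  proof (induction xs arbitrary: g)
    case Nil
    then show ?case by (simp add: one_form_def)
  next
    case (Cons x xs)
    then show ?case
      by (simp add: contr_one_form contr_twist twist_one_form wedge_minus_left wedge_scale_left
          wedge_scale_right)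
  qed
qed

section \<open>Pfaffians of lists, by expansion along the first entry\<close>

definition remove_nth :: "nat \<Rightarrow> 'i list \<Rightarrow> 'i list" where
  "remove_nth i xs = take i xs @ drop (Suc i) xs"

lemma remove_nth_Cons [simp]:
  "remove_nth 0 (x # xs) = xs"
  "remove_nth (Suc i) (x # xs) = x # remove_nth i xs"
  by (auto simp: remove_nth_def)

lemma length_remove_nth [simp]: "i < length xs \<Longrightarrow> length (remove_nth i xs) = length xs - 1"
  by (auto simp: remove_nth_def)

lemma set_remove_nth_subset: "set (remove_nth i xs) \<subseteq> set xs"
  by (auto simp: remove_nth_def dest: in_set_takeD in_set_dropD)

lemma remove_nth_map: "remove_nth i (map f xs) = map f (remove_nth i xs)"
  by (simp add: remove_nth_def take_map drop_map)

lemma wedge_one_form_left: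
  "wedge (one_form \<alpha>) g xs = (\<Sum>i<length xs. (-1) ^ i * \<alpha> (xs ! i) * g (remove_nth i xs))"
proof (induction xs arbitrary: g)
  case (Cons x xs)
  then show ?case
    by (simp add: contr_one_form twist_one_form wedge_minus_left wedge_scale_left
        sum.lessThan_Suc_shift del: sum.lessThan_Suc)
      (simp add: contr_def sum_negf)
qed (simp add: one_form_def)

text \<open>Only values \<open>a u v\<close> with \<open>u\<close> ahead of \<open>v\<close> in the
  list are read, and entries may repeat.\<close>

function pf :: "('i \<Rightarrow> 'i \<Rightarrow> 'a::comm_ring_1) \<Rightarrow> 'i list \<Rightarrow> 'a" where
  "pf a [] = 1"
| "pf a (x # xs) = (\<Sum>i<length xs. (-1) ^ i * a x (xs ! i) * pf a (remove_nth i xs))"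
  by pat_completeness auto
termination
  by (relation "measure (length \<circ> snd)") auto

text \<open>The expansion along the first entry, read as the differential equation of an
  exponential: contracting with \<open>x\<close> multiplies by the row of \<open>x\<close>.\<close>

lemma contr_pf: "contr x (pf a) = wedge (one_form (a x)) (pf a)"
  by (auto simp: contr_def wedge_one_form_left)

lemma pf_odd: "odd (length xs) \<Longrightarrow> pf a xs = 0"
proof (induction a xs rule: pf.induct)
  case (2 a x xs)
  then show ?case by (cases xs) (auto intro!: sum.neutral)
qed auto

lemma twist_pf [simp]: "twist (pf a) = pf a"
  by (auto simp: twist_def fun_eq_iff pf_odd minus_one_power_iff)

lemma pf_cong:
  assumes "\<And>x y. x \<in> set xs \<Longrightarrow> y \<in> set xs \<Longrightarrow> a x y = b x y"
  shows "pf a xs = pf b xs"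
  using assms
proof (induction a xs rule: pf.induct)
  case (2 a x xs)
  have "pf a (remove_nth i xs) = pf b (remove_nth i xs)" if "i < length xs" for i
    using 2 that set_remove_nth_subset[of i xs] by (metis (mono_tags, lifting) lessThan_iff
        set_subset_Cons subsetD)
  then show ?case using 2 by (auto intro!: sum.cong)
qed auto

lemma pf_map: "pf a (map f xs) = pf (\<lambda>x y. a (f x) (f y)) xs"
  by (induction "\<lambda>x y. a (f x) (f y)" xs rule: pf.induct) (auto simp: remove_nth_map intro!: sum.cong)

lemma wedge_pf_one_form: "wedge (pf a) (one_form \<alpha>) = wedge (one_form \<alpha>) (pf a)"
  by (simp add: wedge_one_form_commute)

text \<open>The product on the right satisfies the same recursion as the left side. Contracting it
  gives one term per factor, and the row \<open>b x\<close> can be pulled to the front past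
  \<open>pf a\<close> without a sign because \<open>pf a\<close> lives in even degrees.\<close>

lemma pf_add: "pf (\<lambda>x y. a x y + b x y) xs = wedge (pf a) (pf b) xs"
proof (induction "length xs" arbitrary: xs rule: less_induct)
  case less
  show ?case
  proof (cases xs)
    case (Cons x ys)
    have "contr x (wedge (pf a) (pf b))
        = (\<lambda>l. wedge (one_form (a x)) (wedge (pf a) (pf b)) l
             + wedge (one_form (b x)) (wedge (pf a) (pf b)) l)"
      by (simp add: contr_wedge contr_pf wedge_assoc[symmetric] wedge_pf_one_form)
    also have "\<dots> = wedge (one_form (\<lambda>y. a x y + b x y)) (wedge (pf a) (pf b))"
      by (auto simp: wedge_one_form_left fun_eq_iff sum.distrib[symmetric] algebra_simps)
    finally have "wedge (pf a) (pf b) xs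
        = wedge (one_form (\<lambda>y. a x y + b x y)) (wedge (pf a) (pf b)) ys"
      unfolding Cons contr_def by (rule fun_cong)
    also have "\<dots> = pf (\<lambda>x y. a x y + b x y) xs"
      using less unfolding Cons by (auto simp: wedge_one_form_left intro!: sum.cong)
    finally show ?thesis ..
  qed auto
qed

section \<open>Complementary minors of Pfaffians\<close>

definition alternating_upto :: "nat \<Rightarrow> ('i list \<Rightarrow> 'a::comm_ring_1) \<Rightarrow> bool" where
  "alternating_upto n f \<longleftrightarrow>
    (\<forall>xs x y zs. length xs + length zs + 2 \<le> n \<longrightarrow>
      f (xs @ x # y # zs) = - f (xs @ y # x # zs) \<and> f (xs @ x # x # zs) = 0)"

lemma alternating_upto_swap:
  "alternating_upto n f \<Longrightarrow> length xs + length zs + 2 \<le> n \<Longrightarrow>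
    f (xs @ x # y # zs) = - f (xs @ y # x # zs)"
  unfolding alternating_upto_def by blast

lemma alternating_upto_same:
  "alternating_upto n f \<Longrightarrow> length xs + length zs + 2 \<le> n \<Longrightarrow> f (xs @ x # x # zs) = 0"
  unfolding alternating_upto_def by blast

lemma alternating_upto_contr:
  assumes "alternating_upto (Suc n) f"
  shows "alternating_upto n (contr x f)"
proof -
  have "f ((x # xs) @ u # v # zs) = - f ((x # xs) @ v # u # zs) \<and> f ((x # xs) @ u # u # zs) = 0"
    if "length xs + length zs + 2 \<le> n" for xs u v zs
    using assms that unfolding alternating_upto_def by (metis Suc_le_mono add_Suc length_Cons)
  then show ?thesis unfolding alternating_upto_def contr_def append_Cons by blast
qed

lemma alternating_upto_mono: "alternating_upto n f \<Longrightarrow> m \<le> n \<Longrightarrow> alternating_upto m f"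
  unfolding alternating_upto_def using le_trans by blast

lemma alternating_upto_twist:
  assumes "alternating_upto n f"
  shows "alternating_upto n (twist f)"
proof -
  have "twist f (xs @ x # y # zs) = - twist f (xs @ y # x # zs) \<and> twist f (xs @ x # x # zs) = 0"
    if "length xs + length zs + 2 \<le> n" for xs x y zs
    unfolding twist_def alternating_upto_swap[OF assms that, of x y]
      alternating_upto_same[OF assms that] by simp
  then show ?thesis unfolding alternating_upto_def by blast
qed

text \<open>The essential case has the two arguments at the head. Contracting twice yields four
  terms; in two of them both vectors go to the same factor. The two mixed terms have opposite signs
  by \<open>contr_twist\<close>, so they change places under the swap and cancel when the arguments
  coincide.\<close>

lemma wedge_alternating_aux:
  assumes "alternating_upto n f" "alternating_upto n g" "length xs + length zs + 2 \<le> n"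
  shows "wedge f g (xs @ x # y # zs) = - wedge f g (xs @ y # x # zs)
    \<and> wedge f g (xs @ x # x # zs) = 0"
  using assms
proof (induction xs arbitrary: f g n)
  case Nil
  have swap: "contr x (contr y f') l = - contr y (contr x f') l"
    and same: "contr x (contr x f') l = 0"
    if "alternating_upto n f'" "length l \<le> length zs" for f' :: "'a list \<Rightarrow> 'b" and x y l
    using alternating_upto_swap[OF that(1), of "[]" l y x]
      alternating_upto_same[OF that(1), of "[]" l x] that(2) Nil.prems(3)
    by (simp_all add: contr_def)
  have f: "wedge (contr y (contr x f)) g zs = - wedge (contr x (contr y f)) g zs"
    unfolding wedge_minus_left[symmetric]
    by (rule wedge_cong) (simp_all add: swap[OF Nil.prems(1), of _ y x])
  have f0: "wedge (contr x (contr x f)) g zs = wedge (\<lambda>l. 0) g zs"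
    by (rule wedge_cong) (simp_all add: same[OF Nil.prems(1)])
  have g: "wedge f (contr y (contr x g)) zs = - wedge f (contr x (contr y g)) zs"
    unfolding wedge_minus_right[symmetric]
    by (rule wedge_cong) (simp_all add: swap[OF Nil.prems(2), of _ y x])
  have g0: "wedge f (contr x (contr x g)) zs = wedge f (\<lambda>l. 0) zs"
    by (rule wedge_cong) (simp_all add: same[OF Nil.prems(2)])
  show ?case using f g f0 g0 by (simp add: contr_twist wedge_minus_left)
next
  case (Cons u xs)
  then obtain n' where n: "n = Suc n'" by (cases n) auto
  have "alternating_upto n' f" "alternating_upto n' g" "alternating_upto n' (contr u f)"
      "alternating_upto n' (contr u g)"
    using Cons.prems alternating_upto_contr alternating_upto_mono[of n _ n'] unfolding n by auto
  then show ?case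
    using Cons.IH[of n' "contr u f" g] Cons.IH[of n' "twist f" "contr u g"] Cons.prems(3)
    unfolding n by (simp add: alternating_upto_twist)
qed

lemma alternating_upto_wedge:
  "alternating_upto n f \<Longrightarrow> alternating_upto n g \<Longrightarrow> alternating_upto n (wedge f g)"
  unfolding alternating_upto_def[of n "wedge f g"]
  by (intro allI impI) (rule wedge_alternating_aux)

lemma one_form_eq_0: "length l \<noteq> 1 \<Longrightarrow> one_form \<alpha> l = 0"
  by (auto simp: one_form_def split: list.split)

lemma alternating_upto_one_form [simp]: "alternating_upto n (one_form \<alpha>)"
  by (simp add: alternating_upto_def one_form_eq_0)

lemma alternating_upto_unit_form [simp]: "alternating_upto n unit_form"
  by (simp add: alternating_upto_def unit_form_def)

definition alternating_fun :: "('i \<Rightarrow> 'i \<Rightarrow> 'a::comm_ring_1) \<Rightarrow> bool" where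
  "alternating_fun a \<longleftrightarrow> (\<forall>x y. a x y = - a y x) \<and> (\<forall>x. a x x = 0)"

lemma wedge_one_form_self: "wedge (one_form \<alpha>) (one_form \<alpha>) = (\<lambda>l. 0)"
proof
  fix l
  show "wedge (one_form \<alpha>) (one_form \<alpha>) l = 0"
  proof (cases l)
    case (Cons x xs)
    then show ?thesis
      by (simp add: contr_one_form twist_one_form wedge_minus_left wedge_scale_left wedge_scale_right)
  qed (simp add: one_form_def)
qed

lemma contr_contr_pf:
  "contr y (contr x (pf a)) l = a x y * pf a l - wedge (wedge (one_form (a x)) (one_form (a y))) (pf a) l"
  by (simp add: contr_pf contr_wedge contr_one_form twist_one_form wedge_minus_left wedge_scale_left
      wedge_assoc)

text \<open>A pair at the head is settled by \<open>contr_contr_pf\<close>, whose right side is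
  visibly alternating in the two vectors. A pair further back is a pair in the product of the first
  row with \<open>pf a\<close> on a list one shorter; this descent is why alternation is stated up
  to a length.\<close>

lemma alternating_upto_pf:
  assumes a: "alternating_fun a"
  shows "alternating_upto n (pf a)"
proof (induction n)
  case (Suc n)
  have "pf a (xs @ x # y # zs) = - pf a (xs @ y # x # zs) \<and> pf a (xs @ x # x # zs) = 0"
    if len: "length xs + length zs + 2 \<le> Suc n" for xs x y zs
  proof (cases xs)
    case Nil
    have "wedge (one_form (a x)) (one_form (a y)) = (\<lambda>l. - wedge (one_form (a y)) (one_form (a x)) l)"
      using wedge_one_form_commute[of "a x" "one_form (a y)"]
      by (simp add: twist_one_form fun_eq_iff wedge_minus_left)
    moreover have "a x y = - a y x" "a x x = 0" using a unfolding alternating_fun_def by blast+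
    ultimately have "contr y (contr x (pf a)) zs = - contr x (contr y (pf a)) zs"
        "contr x (contr x (pf a)) zs = 0"
      by (simp_all add: contr_contr_pf wedge_minus_left wedge_one_form_self)
    then show ?thesis using Nil by (simp add: contr_def)
  next
    case (Cons u us)
    have "pf a (u # l) = wedge (one_form (a u)) (pf a) l" for l
      using contr_pf[of u a] by (simp add: contr_def fun_eq_iff)
    then show ?thesis
      using Cons wedge_alternating_aux[OF _ Suc.IH, of "one_form (a u)" us zs x y] len
      by (simp del: pf.simps)
  qed
  then show ?case unfolding alternating_upto_def by blast
qed (simp add: alternating_upto_def)

lemma alternating_upto_repeated:
  assumes "alternating_upto (Suc (length xs)) f" "x \<in> set xs"
  shows "f (x # xs) = 0"
  using assms
proof (induction xs arbitrary: f)
  case (Cons y ys)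
  show ?case
  proof (cases "x = y")
    case True
    then show ?thesis using alternating_upto_same[OF Cons.prems(1), of "[]" ys x] by simp
  next
    case False
    have "f (x # y # ys) = - contr y f (x # ys)"
      using alternating_upto_swap[OF Cons.prems(1), of "[]" ys x y] by (simp add: contr_def)
    also have "\<dots> = 0"
      using Cons.IH[of "contr y f"] Cons.prems False
      by (auto intro: alternating_upto_contr)
    finally show ?thesis .
  qed
qed auto

section \<open>Coordinate forms and Jacobi's identity for complementary Pfaffians\<close>

definition delta :: "'i \<Rightarrow> 'i list \<Rightarrow> 'a::comm_ring_1" where
  "delta y = one_form (\<lambda>x. of_bool (x = y))"

text \<open>The decomposable form dual to \<open>ys\<close>. Multiplying by it deletes the entries
  \<open>ys\<close> from the argument list up to sign, which is how complementary sub-Pfaffians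
  arise.\<close>

primrec deltas :: "'i list \<Rightarrow> 'i list \<Rightarrow> 'a::comm_ring_1" where
  "deltas [] = unit_form"
| "deltas (y # ys) = wedge (delta y) (deltas ys)"

lemma alternating_upto_deltas: "alternating_upto n (deltas ys)"
  by (induction ys) (auto intro: alternating_upto_wedge simp: delta_def)

lemma contr_deltas:
  fixes l :: "'i list"
  shows "contr z (deltas ys) l
    = (\<Sum>i<length ys. (-1) ^ i * of_bool (z = ys ! i) * deltas (remove_nth i ys) l :: 'a::comm_ring_1)"
proof (induction ys arbitrary: l)
  case (Cons y ys)
  have "contr z (deltas (y # ys)) l
      = of_bool (z = y) * deltas ys l - wedge (delta y) (contr z (deltas ys)) l"
    by (simp add: contr_wedge delta_def contr_one_form twist_one_form wedge_minus_left
        wedge_scale_left)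
  also have "contr z (deltas ys)
      = (\<lambda>l. \<Sum>i<length ys. (-1) ^ i * of_bool (z = ys ! i) * deltas (remove_nth i ys) l :: 'a)"
    by (rule ext) (rule Cons.IH)
  also have "wedge (delta y) \<dots> l
      = (\<Sum>i<length ys. (-1) ^ i * of_bool (z = ys ! i) * wedge (delta y) (deltas (remove_nth i ys)) l)"
    by (simp add: delta_def wedge_one_form_left sum_distrib_left)
      (subst sum.swap, simp add: mult_ac)
  finally show ?case
    by (simp add: sum.lessThan_Suc_shift sum_negf del: sum.lessThan_Suc)
qed simp

text \<open>
  The inverse matrix turns \<open>delta y\<close> into a combination of the rows of \<open>a\<close>, each of which is traded
  for a contraction. Contracting the whole product with an entry of \<open>L\<close> gives zero on \<open>L\<close>, so the
  contraction can be moved to the dual vectors, where it expands \<open>pf p\<close> along its first row.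
\<close>

lemma wedge_deltas_pf:
  fixes a p :: "'i \<Rightarrow> 'i \<Rightarrow> 'a::comm_ring_1"
  assumes a: "alternating_fun a"
    and inv: "\<And>y w. y \<in> set L \<Longrightarrow> w \<in> set L \<Longrightarrow> (\<Sum>z\<in>set L. p y z * a z w) = - of_bool (w = y)"
    and "set ys \<subseteq> set L"
  shows "wedge (deltas ys) (pf a) L = pf p ys * pf a L"
  using assms(3)
proof (induction "length ys" arbitrary: ys rule: less_induct)
  case less
  show ?case
  proof (cases ys)
    case (Cons y us)
    let ?D = "deltas us :: 'i list \<Rightarrow> 'a"
    let ?X = "wedge ?D (pf a)"
    have y: "y \<in> set L" using less.prems Cons by auto
    have contr: "wedge (one_form (a z)) ?X L = - wedge (contr z ?D) (pf a) L"
      if z: "z \<in> set L" for z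
    proof -
      have "contr z ?X L = 0"
        unfolding contr_def
        by (rule alternating_upto_repeated)
          (use z in \<open>auto intro: alternating_upto_wedge alternating_upto_deltas alternating_upto_pf a\<close>)
      moreover have "wedge (one_form (a z)) ?X = wedge (twist ?D) (contr z (pf a))"
        by (metis contr_pf wedge_assoc wedge_one_form_commute)
      ultimately show ?thesis by (simp add: contr_wedge eq_neg_iff_add_eq_0 add.commute)
    qed
    have "wedge (deltas ys) (pf a) L = wedge (delta y) ?X L"
      by (simp add: Cons wedge_assoc)
    \<comment> \<open>The two one-forms agree only on entries of \<open>L\<close>, where
      \<open>inv\<close> is available; the minus signs undo the one in \<open>inv\<close>.\<close>
    also have "\<dots> = wedge (\<lambda>l. \<Sum>z\<in>set L. - p y z * one_form (a z) l) ?X L"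
    proof (rule wedge_cong)
      fix l assume l: "set l \<subseteq> set L"
      show "delta y l = (\<Sum>z\<in>set L. - p y z * one_form (a z) l)"
      proof (cases "\<exists>w. l = [w]")
        case True
        then obtain w where "l = [w]" by auto
        then show ?thesis using inv[OF y, of w] l
          by (auto simp: delta_def one_form_def sum_negf)
      qed (auto simp: delta_def one_form_def split: list.split)
    qed auto
    also have "\<dots> = (\<Sum>z\<in>set L. - p y z * wedge (one_form (a z)) ?X L)"
      by (simp only: wedge_sum_left wedge_scale_left)
    also have "\<dots> = (\<Sum>z\<in>set L. p y z * wedge (contr z ?D) (pf a) L)"
      by (simp add: contr)
    also have "\<dots> = (\<Sum>z\<in>set L. \<Sum>i<length us. of_bool (z = us ! i) *
        ((-1) ^ i * p y z * wedge (deltas (remove_nth i us)) (pf a) L))"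
      by (subst contr_deltas[abs_def]) 
        (simp only: wedge_sum_left wedge_scale_left sum_distrib_left mult.assoc, simp add: mult_ac)
    also have "\<dots> = (\<Sum>i<length us. (-1) ^ i * p y (us ! i) * wedge (deltas (remove_nth i us)) (pf a) L)"
    proof (subst sum.swap, rule sum.cong)
      fix i assume "i \<in> {..<length us}"
      then have "us ! i \<in> set L" using less.prems Cons by auto
      then show "(\<Sum>z\<in>set L. of_bool (z = us ! i) *
          ((-1) ^ i * p y z * wedge (deltas (remove_nth i us)) (pf a) L))
        = (-1) ^ i * p y (us ! i) * wedge (deltas (remove_nth i us)) (pf a) L"
        by (simp add: of_bool_def if_distrib[of "\<lambda>c. c * _"] sum.delta cong: if_cong)
    qed simp
    also have "\<dots> = (\<Sum>i<length us. (-1) ^ i * p y (us ! i) * (pf p (remove_nth i us) * pf a L))"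
    proof (rule sum.cong)
      fix i assume "i \<in> {..<length us}"
      then have "wedge (deltas (remove_nth i us)) (pf a) L = pf p (remove_nth i us) * pf a L"
        using less.prems set_remove_nth_subset[of i us] unfolding Cons
        by (intro less.hyps) (auto simp: Cons)
      then show "(-1) ^ i * p y (us ! i) * wedge (deltas (remove_nth i us)) (pf a) L
          = (-1) ^ i * p y (us ! i) * (pf p (remove_nth i us) * pf a L)" by simp
    qed simp
    finally show ?thesis by (simp add: Cons sum_distrib_right mult.assoc)
  qed simp
qed

text \<open>The sign of the shuffle that moves the entries in \<open>I\<close> to the front.\<close>

primrec shuffle_sign :: "'i list \<Rightarrow> 'i set \<Rightarrow> 'a::comm_ring_1" where
  "shuffle_sign [] I = 1"
| "shuffle_sign (x # xs) I
    = (if x \<in> I then 1 else (-1) ^ length (subtuple xs I)) * shuffle_sign xs I"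

lemma shuffle_sign_square: "shuffle_sign xs I * shuffle_sign xs I = (1 :: 'a::comm_ring_1)"
proof (induction xs)
  case (Cons x xs)
  have "(if x \<in> I then 1 else (-1) ^ length (subtuple xs I)) * (if x \<in> I then 1 else (-1) ^ length (subtuple xs I)) = (1::'a)"
    by (auto simp: power_mult_distrib[symmetric])
  then show ?case using Cons by (simp add: mult_ac mult.assoc[symmetric])
qed simp

lemma subtuple_simps [simp]:
  "subtuple [] I = []"
  "subtuple (x # xs) I = (if x \<in> I then x # subtuple xs I else subtuple xs I)"
  by (auto simp: subtuple_def)

lemma subtuple_cong: "I \<inter> set xs = K \<inter> set xs \<Longrightarrow> subtuple xs I = subtuple xs K"
  unfolding subtuple_def by (rule filter_cong) auto

lemma shuffle_sign_cong: "I \<inter> set xs = K \<inter> set xs \<Longrightarrow> shuffle_sign xs I = shuffle_sign xs K"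
proof (induction xs)
  case (Cons x xs)
  have "I \<inter> set xs = K \<inter> set xs" "x \<in> I \<longleftrightarrow> x \<in> K" using Cons.prems by auto
  then show ?case using Cons.IH subtuple_cong[of I xs K] by simp
qed simp

lemma set_subtuple: "set (subtuple xs I) = set xs \<inter> I"
  by (auto simp: subtuple_def)

text \<open>Each step of the recursion decides whether the head goes to \<open>f\<close>, that is,
  belongs to \<open>I\<close>. A head outside \<open>I\<close> must pass the later arguments of
  \<open>f\<close>, which is its factor in \<open>shuffle_sign\<close>. Distinctness lets subsets
  stand for sets of positions.\<close>

lemma wedge_expand:
  fixes f g :: "'i list \<Rightarrow> 'a::comm_ring_1"
  assumes "distinct L"
  shows "wedge f g L
    = (\<Sum>I\<in>Pow (set L). shuffle_sign L I * f (subtuple L I) * g (subtuple L (- I)))"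
  using assms
proof (induction L arbitrary: f g)
  case (Cons x xs)
  let ?t = "\<lambda>I. shuffle_sign (x # xs) I * f (subtuple (x # xs) I) * g (subtuple (x # xs) (- I))"
  have x: "x \<notin> set xs" using Cons.prems by simp
  have "(\<Sum>I\<in>Pow (set (x # xs)). ?t I)
      = (\<Sum>I\<in>Pow (set xs). ?t I) + (\<Sum>I\<in>insert x ` Pow (set xs). ?t I)"
    unfolding list.set Pow_insert using x by (intro sum.union_disjoint) auto
  also have "(\<Sum>I\<in>insert x ` Pow (set xs). ?t I) = (\<Sum>I\<in>Pow (set xs). ?t (insert x I))"
    using x by (intro sum.reindex_cong[of "insert x"]) (auto intro!: inj_onI)
  also have "\<dots> = wedge (contr x f) g xs"
    unfolding Cons.IH[OF distinct.simps(2)[THEN iffD1, OF Cons.prems, THEN conjunct2]]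
  proof (rule sum.cong)
    fix I assume "I \<in> Pow (set xs)"
    have "shuffle_sign xs (insert x I) = (shuffle_sign xs I :: 'a)"
      "subtuple xs (insert x I) = subtuple xs I" "subtuple xs (- insert x I) = subtuple xs (- I)"
      using x by (auto intro!: shuffle_sign_cong subtuple_cong)
    then show "?t (insert x I) = shuffle_sign xs I * contr x f (subtuple xs I) * g (subtuple xs (- I))"
      by (simp add: contr_def)
  qed simp
  also have "(\<Sum>I\<in>Pow (set xs). ?t I) = wedge (twist f) (contr x g) xs"
    unfolding Cons.IH[OF distinct.simps(2)[THEN iffD1, OF Cons.prems, THEN conjunct2]]
    by (rule sum.cong) (use x in \<open>auto simp: contr_def twist_def mult_ac\<close>)
  finally show ?case by simp
qed simp

lemma deltas_head_notin: "x \<notin> set ys \<Longrightarrow> deltas ys (x # l) = 0"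
  by (subst contr_deltas[unfolded contr_def]) (auto intro!: sum.neutral)

lemma deltas_head_eq:
  assumes "y \<notin> set ys"
  shows "deltas (y # ys) (y # l) = deltas ys l"
  using assms
  by (subst contr_deltas[unfolded contr_def])
    (auto simp add: sum.lessThan_Suc_shift simp del: sum.lessThan_Suc deltas.simps intro!: sum.neutral)

lemma deltas_notin_argument: "y \<notin> set l \<Longrightarrow> deltas (y # ys) l = 0"
  by (auto simp: delta_def wedge_one_form_left intro!: sum.neutral) 

text \<open>Duality of the coordinate forms. No permutation sign appears because both tuples inherit
  their order from \<open>L\<close>.\<close>

lemma deltas_subtuple:
  assumes "distinct L"
  shows "deltas (subtuple L K) (subtuple L I) = of_bool (I \<inter> set L = K \<inter> set L)"
  using assms
proof (induction L)
  case (Cons x xs)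
  have x: "x \<notin> set xs" using Cons.prems by simp
  then have "x \<notin> set (subtuple xs I)" "x \<notin> set (subtuple xs K)" by (auto simp: set_subtuple)
  moreover have "I \<inter> set (x # xs) = K \<inter> set (x # xs)
      \<longleftrightarrow> (x \<in> I \<longleftrightarrow> x \<in> K) \<and> I \<inter> set xs = K \<inter> set xs" using x by auto
  ultimately show ?case using Cons
    by (auto simp: deltas_head_notin deltas_head_eq deltas_notin_argument simp del: deltas.simps)
qed simp

lemma wedge_deltas_subtuple:
  assumes "distinct L" "K \<subseteq> set L"
  shows "wedge (deltas (subtuple L K)) g L = shuffle_sign L K * g (subtuple L (- K))"
proof -
  have "wedge (deltas (subtuple L K)) g L
      = (\<Sum>I\<in>Pow (set L). if I = K then shuffle_sign L I * g (subtuple L (- I)) else 0)"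
    unfolding wedge_expand[OF assms(1)]
    by (rule sum.cong) (use assms in \<open>auto simp: deltas_subtuple Int_absorb2\<close>)
  then show ?thesis using assms(2) by simp
qed

context
  fixes a p :: "'i \<Rightarrow> 'i \<Rightarrow> 'a::comm_ring_1" and L :: "'i list"
  assumes a: "alternating_fun a" and L: "distinct L"
    and inv: "\<And>y w. y \<in> set L \<Longrightarrow> w \<in> set L \<Longrightarrow> (\<Sum>z\<in>set L. p y z * a z w) = - of_bool (w = y)"
begin

text \<open>The product of \<open>deltas (subtuple L K)\<close> with \<open>pf a\<close> is
  evaluated on \<open>L\<close> in two ways: duality leaves the complementary Pfaffian, and
  \<open>wedge_deltas_pf\<close> gives the Pfaffian of \<open>p\<close>.\<close>

lemma jacobi_pf:
  assumes "K \<subseteq> set L"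
  shows "pf p (subtuple L K) * pf a L = shuffle_sign L K * pf a (subtuple L (- K))"
  using wedge_deltas_subtuple[OF L assms, of "pf a"] wedge_deltas_pf[OF a inv, of "subtuple L K"]
  by (simp add: set_subtuple)

text \<open>The exterior product and Jacobi's identity contribute the same shuffle sign, whose
  square is one. Passing to complements then makes the sum run over the part handed to
  \<open>F\<close>.\<close>

lemma pf_mult_wedge_pf_inverse:
  "pf a L * wedge (pf p) F L = (\<Sum>I\<in>Pow (set L). pf a (subtuple L I) * F (subtuple L I))"
proof -
  have "pf a L * wedge (pf p) F L
      = (\<Sum>K\<in>Pow (set L). shuffle_sign L K * (pf p (subtuple L K) * pf a L) * F (subtuple L (- K)))"
    unfolding wedge_expand[OF L] sum_distrib_left by (simp add: mult_ac)
  also have "\<dots> = (\<Sum>K\<in>Pow (set L). pf a (subtuple L (- K)) * F (subtuple L (- K)))"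
  proof (rule sum.cong)
    fix K assume "K \<in> Pow (set L)"
    then have "shuffle_sign L K * (pf p (subtuple L K) * pf a L)
        = shuffle_sign L K * shuffle_sign L K * pf a (subtuple L (- K))"
      by (simp add: jacobi_pf mult.assoc)
    then show "shuffle_sign L K * (pf p (subtuple L K) * pf a L) * F (subtuple L (- K))
        = pf a (subtuple L (- K)) * F (subtuple L (- K))"
      by (simp add: shuffle_sign_square)
  qed simp
  also have "\<dots> = (\<Sum>I\<in>Pow (set L). pf a (subtuple L I) * F (subtuple L I))"
    by (rule sum.reindex_bij_witness[of _ "\<lambda>I. set L - I" "\<lambda>I. set L - I"])
      (auto intro!: arg_cong2[where f="(*)"] arg_cong[where f="pf a"] arg_cong[where f=F] subtuple_cong)
  finally show ?thesis .
qed

text \<open>Jacobi's identity for the full index set. It yields that the Pfaffian is nonzero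
  directly from the inverse, without the relation between Pfaffian and determinant.\<close>

lemma pf_mult_pf_inverse: "pf p L * pf a L = 1"
proof -
  have "subtuple L (set L) = L" "subtuple L (- set L) = []"
    by (auto simp: subtuple_def filter_empty_conv)
  moreover have "shuffle_sign l I = (1::'a)" if "set l \<subseteq> I" for l :: "'i list" and I
    using that by (induction l) auto
  ultimately show ?thesis using jacobi_pf[of "set L"] by simp
qed

lemma wedge_delta_nth:
  assumes "distinct l" "i < length l"
  shows "wedge (delta (l ! i)) g l = (-1) ^ i * g (remove_nth i l)"
proof -
  have "wedge (delta (l ! i)) g l = (\<Sum>k<length l. if k = i then (-1) ^ i * g (remove_nth i l) else 0)"
    unfolding delta_def wedge_one_form_left
    by (rule sum.cong) (use assms in \<open>auto simp: nth_eq_iff_index_eq\<close>)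
  then show ?thesis using assms by simp
qed

text \<open>This identifies the entries of \<open>p\<close> with those of the copfaffian matrix.
  Once position \<open>i\<close> is gone, the entry at \<open>j\<close> sits at
  \<open>j - 1\<close>; the signs of the two deletions multiply to exponent
  \<open>i + j - 1\<close>, of the same parity as \<open>i + j + 1\<close>.\<close>

lemma pf_remove_two:
  assumes "i < j" "j < length L"
  shows "p (L ! i) (L ! j) * pf a L = (-1) ^ (i + j + 1) * pf a (remove_nth i (remove_nth j L))"
proof -
  have d: "distinct (remove_nth i L)" 
    using L unfolding remove_nth_def
    by (simp add: set_take_disj_set_drop_if_distinct)
  have n: "remove_nth i L ! (j - 1) = L ! j"
    using assms by (auto simp: remove_nth_def nth_append)
  have r: "remove_nth (j - 1) (remove_nth i L) = remove_nth i (remove_nth j L)"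
    using assms by (intro nth_equalityI) (auto simp: remove_nth_def nth_append)
  have "p (L ! i) (L ! j) * pf a L = wedge (deltas [L ! i, L ! j]) (pf a) L"
    using wedge_deltas_pf[OF a inv, of "[L ! i, L ! j]"] assms by (simp add: remove_nth_def)
  also have "\<dots> = wedge (delta (L ! i)) (wedge (delta (L ! j)) (pf a)) L"
    by (simp add: wedge_assoc)
  also have "\<dots> = (-1) ^ i * wedge (delta (remove_nth i L ! (j - 1))) (pf a) (remove_nth i L)"
    unfolding n using assms by (simp add: wedge_delta_nth[OF L])
  also have "\<dots> = (-1) ^ i * ((-1) ^ (j - 1) * pf a (remove_nth i (remove_nth j L)))"
    using assms r by (subst wedge_delta_nth[OF d]) auto
  also have "(-1) ^ i * ((-1) ^ (j - 1) * c) = (-1) ^ (i + j + 1) * c" for c :: 'a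
    using assms by (cases j) (auto simp: power_add)
  finally show ?thesis .
qed

end

section \<open>Pfaffians of reversed lists\<close>

lemma remove_nth_rev: "i < length xs \<Longrightarrow> remove_nth i (rev xs) = rev (remove_nth (length xs - Suc i) xs)"
  by (rule nth_equalityI) (auto simp: remove_nth_def rev_nth nth_append Suc_diff_Suc)

text \<open>For even length, the head of \<open>xs\<close>, which is last in \<open>rev xs\<close>,
  moves to the front past an odd number of entries. The resulting minus sign cancels the one in the
  negated first row. For odd length both sides vanish.\<close>

lemma pf_rev:
  assumes a: "alternating_fun a"
  shows "pf (\<lambda>x y. - a x y) (rev xs) = pf a xs"
proof (induction "length xs" arbitrary: xs rule: less_induct)
  case less
  have alt: "alternating_fun (\<lambda>x y. - a x y)" using a
    unfolding alternating_fun_def by (metis minus_zero)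
  have move: "f (l @ [x]) = (-1) ^ length l * f (x # l)"
    if "alternating_upto (Suc (length l)) f" for f :: "'a list \<Rightarrow> 'b" and l x
    using that
  proof (induction l arbitrary: f)
    case (Cons y l)
    have "f (y # l @ [x]) = contr y f (l @ [x])" by (simp add: contr_def)
    also have "\<dots> = (-1) ^ length l * f (y # x # l)"
      using Cons.IH[of "contr y f"] Cons.prems alternating_upto_contr by (fastforce simp: contr_def)
    also have "f (y # x # l) = - f (x # y # l)"
      using alternating_upto_swap[OF Cons.prems, of "[]" l y x] by simp
    finally show ?case by simp
  qed simp
  show ?case
  proof (cases xs)
    case (Cons x us)
    show ?thesis
    proof (cases "odd (length us)")
      case odd: True
      have "pf (\<lambda>x y. - a x y) (rev xs) = - pf (\<lambda>x y. - a x y) (x # rev us)"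
        using odd move[of "rev us" "pf (\<lambda>x y. - a x y)" x] alternating_upto_pf[OF alt]
        by (simp add: Cons)
      also have "\<dots> = (\<Sum>i<length us. (-1) ^ i * a x (rev us ! i) * pf (\<lambda>x y. - a x y) (remove_nth i (rev us)))"
        by (simp add: sum_negf)
      also have "\<dots> = (\<Sum>i<length us. (-1) ^ i * a x (us ! (length us - Suc i)) * pf a (remove_nth (length us - Suc i) us))"
        using less unfolding Cons by (intro sum.cong) (auto simp: rev_nth remove_nth_rev)
      also have "\<dots> = (\<Sum>i<length us. (-1) ^ i * a x (us ! i) * pf a (remove_nth i us))"
      proof (rule sum.reindex_bij_witness[of _ "\<lambda>i. length us - Suc i" "\<lambda>i. length us - Suc i"])
        \<comment> \<open>Reflecting the positions of a list of odd length preserves their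
          parity.\<close>
        fix i assume "i \<in> {..<length us}"
        then have "even i \<longleftrightarrow> even (length us - Suc i)" using odd by auto
        then have "(-1) ^ i = ((-1) ^ (length us - Suc i) :: 'b)"
          by (simp add: minus_one_power_iff)
        then show "(-1) ^ (length us - Suc i) * a x (us ! (length us - Suc i)) * pf a (remove_nth (length us - Suc i) us)
          = (-1) ^ i * a x (us ! (length us - Suc i)) * pf a (remove_nth (length us - Suc i) us)" by simp
      qed auto
      finally show ?thesis by (simp add: Cons)
    qed (simp add: Cons pf_odd del: pf.simps)
  qed simp
qed

section \<open>The lemma of Lindstroem, Gessel and Viennot\<close>

text \<open>The cut is made at the arc leaving \<open>w\<close>. If \<open>w\<close> is the end of
  the path there is no such arc, and the part after \<open>w\<close> is correctly the empty
  list.\<close>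

definition path_before :: "('v, 'e) pre_digraph \<Rightarrow> 'v \<Rightarrow> 'e list \<Rightarrow> 'e list" where
  "path_before D w = takeWhile (\<lambda>e. tail D e \<noteq> w)"

definition path_after :: "('v, 'e) pre_digraph \<Rightarrow> 'v \<Rightarrow> 'e list \<Rightarrow> 'e list" where
  "path_after D w = dropWhile (\<lambda>e. tail D e \<noteq> w)"

lemma path_before_after [simp]: "path_before D w q @ path_after D w q = q"
  by (simp add: path_before_def path_after_def)

lemma (in wf_digraph) awalk_path_before_after:
  assumes "awalk u q v" "w \<in> set (awalk_verts u q)"
  shows "awalk u (path_before G w q) w \<and> awalk w (path_after G w q) v"
  using assms
proof (induction q arbitrary: u)
  case Nil
  then show ?case by (auto simp: path_before_def path_after_def awalk_Nil_iff)
next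
  case (Cons e es)
  show ?case
  proof (cases "tail G e = w")
    case True
    then show ?thesis using Cons.prems
      by (auto simp: path_before_def path_after_def awalk_Nil_iff awalk_Cons_iff)
  next
    case False
    then show ?thesis using Cons
      by (auto simp: path_before_def path_after_def awalk_Cons_iff)
  qed
qed

text \<open>Acyclicity in terms of closed walks, the form in which it is applied to concatenated
  pieces of paths.\<close>

definition acyclic_wf :: "('v, 'e) pre_digraph \<Rightarrow> bool" where
  "acyclic_wf D \<longleftrightarrow> wf_digraph D \<and> (\<forall>u p. pre_digraph.awalk D u p u \<longrightarrow> p = [])"

lemma acyclic_digraph_imp_acyclic_wf:
  assumes "acyclic_digraph D"
  shows "acyclic_wf D"
proof -
  interpret nomulti_digraph D using assms by (simp add: acyclic_digraph_def)
  have "p = []" if "awalk u p u" for u p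
    using that assms closed_w_imp_cycle[of p] 
    by (auto simp: acyclic_digraph_def closed_w_def)
  then show ?thesis by (simp add: acyclic_wf_def wf_digraph_axioms)
qed

context
  fixes D :: "('v, 'e) pre_digraph"
  assumes acyclic: "acyclic_wf D"
begin

interpretation wf_digraph D
  using acyclic by (simp add: acyclic_wf_def)

lemma awalk_loop_Nil: "awalk u p u \<Longrightarrow> p = []"
  using acyclic by (auto simp: acyclic_wf_def)

lemma awalk_antisym:
  assumes "awalk u p v" "awalk v q u"
  shows "u = v"
  using awalk_loop_Nil[OF awalk_appendI[OF assms]] assms by (simp add: awalk_Nil_iff)

text \<open>A repeated vertex would enclose a closed walk. Since every walk is therefore a path,
  pieces of different paths may be glued without checking for repetitions.\<close>

lemma paths_acyclic: "paths D u v = {p. awalk u p v}"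
proof -
  have "distinct (awalk_verts u p)" if p: "awalk u p v" for p
  proof (rule ccontr)
    assume "\<not> ?thesis"
    then obtain q r s where "p = q @ r @ s" "closed_w r"
      using awalk_not_distinct_decomp[OF p] closed_w_def by (metis length_greater_0_conv)
    then show False using awalk_loop_Nil by (auto simp: closed_w_def)
  qed
  then show ?thesis by (auto simp: paths_def apath_def)
qed

text \<open>The first piece cannot leave \<open>w\<close> before its end, as this would close a
  walk. Cutting thus recovers the glued pieces, which makes exchanging tails an involution.\<close>

lemma path_before_after_append:
  assumes "awalk u p w" "awalk w q v"
  shows "path_before D w (p @ q) = p" "path_after D w (p @ q) = q"
proof -
  have "tail D e \<noteq> w" if ep: "e \<in> set p" for e
  proof
    assume e: "tail D e = w"
    obtain p1 p2 where p: "p = p1 @ e # p2" using ep by (meson split_list)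
    then have "awalk w (e # p2) w" using assms(1) e by (auto simp: awalk_Cons_iff)
    then show False using awalk_loop_Nil by blast
  qed
  moreover have "q = [] \<or> tail D (hd q) = w"
    using assms(2) by (cases q) (auto simp: awalk_Cons_iff)
  ultimately have "path_before D w (p @ q) = p \<and> path_after D w (p @ q) = q"
    by (cases q) (auto simp: path_before_def path_after_def takeWhile_append dropWhile_append)
  then show "path_before D w (p @ q) = p" "path_after D w (p @ q) = q" by auto
qed

lemma path_verts_append:
  assumes "awalk u p w" "awalk w q v"
  shows "path_verts D u (p @ q) = path_verts D u p \<union> path_verts D w q"
  using set_awalk_verts_append[OF assms] by (simp add: path_verts_def)

text \<open>A second common vertex would lie both before and after \<open>w\<close>, contradicting
  acyclicity. It follows that a vertex other than \<open>w\<close> lies on at most one half of a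
  path through \<open>w\<close>.\<close>

lemma path_verts_inter:
  assumes "awalk u p w" "awalk w q v"
  shows "path_verts D u p \<inter> path_verts D w q \<subseteq> {w}"
proof
  fix y assume y: "y \<in> path_verts D u p \<inter> path_verts D w q"
  have "awalk y (path_after D y p) w" "awalk w (path_before D y q) y"
    using y awalk_path_before_after[OF assms(1), of y] awalk_path_before_after[OF assms(2), of y]
    by (auto simp: path_verts_def)
  then show "y \<in> {w}" using awalk_antisym by blast
qed

lemma path_verts_ends:
  assumes "awalk u p v"
  shows "u \<in> path_verts D u p" "v \<in> path_verts D u p"
  using assms by (auto simp: path_verts_def intro: hd_in_awalk_verts)

section \<open>The involution that exchanges the tails of two intersecting paths\<close>

definition occ :: "'v list \<Rightarrow> (nat \<Rightarrow> 'e list) \<Rightarrow> 'v \<Rightarrow> nat set" where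
  "occ us f w = {i. i < length us \<and> w \<in> path_verts D (us ! i) (f i)}"

definition shared :: "'v list \<Rightarrow> (nat \<Rightarrow> 'e list) \<Rightarrow> 'v set" where
  "shared us f = {w. \<exists>i j. i \<noteq> j \<and> i \<in> occ us f w \<and> j \<in> occ us f w}"

text \<open>
  The chosen vertex depends on the family only through the set of shared vertices, and the two
  indices only through the paths containing that vertex. Swapping the tails changes none of this,
  which makes it an involution.
\<close>

definition crossing :: "'v list \<Rightarrow> (nat \<Rightarrow> 'e list) \<Rightarrow> 'v \<times> nat \<times> nat" where
  "crossing us f = (let w = (SOME w. w \<in> shared us f); i = Min (occ us f w)
     in (w, i, Min (occ us f w - {i})))"

definition swap_tails :: "'v list \<Rightarrow> (nat \<Rightarrow> 'e list) \<Rightarrow> nat \<Rightarrow> 'e list" where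
  "swap_tails us f = (case crossing us f of (w, i, j) \<Rightarrow>
     f(i := path_before D w (f i) @ path_after D w (f j),
       j := path_before D w (f j) @ path_after D w (f i)))"

definition swap_perm :: "'v list \<Rightarrow> (nat \<Rightarrow> 'e list) \<Rightarrow> (nat \<Rightarrow> nat) \<Rightarrow> nat \<Rightarrow> nat" where
  "swap_perm us f \<pi> = (case crossing us f of (w, i, j) \<Rightarrow> \<pi> \<circ> transpose i j)"

lemma crossing_props:
  assumes "shared us f \<noteq> {}" "crossing us f = (w, i, j)"
  shows "w \<in> shared us f" "i \<in> occ us f w" "j \<in> occ us f w" "i \<noteq> j"
proof -
  have w: "w = (SOME w. w \<in> shared us f)" and i: "i = Min (occ us f w)"
    and j: "j = Min (occ us f w - {i})"
    using assms(2) by (auto simp: crossing_def Let_def)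
  show w': "w \<in> shared us f" unfolding w using assms(1) by (rule some_in_eq[THEN iffD2])
  have fin: "finite (occ us f w)" by (simp add: occ_def)
  have "occ us f w - {i} \<noteq> {}" "occ us f w \<noteq> {}" using w' by (auto simp: shared_def)
  then have "i \<in> occ us f w" "j \<in> occ us f w - {i}"
    using fin Min_in[of "occ us f w"] Min_in[of "occ us f w - {i}"] i j by auto
  then show "i \<in> occ us f w" "j \<in> occ us f w" "i \<noteq> j" by auto
qed

lemma swap_tails_main:
  assumes f: "\<And>k. k < length us \<Longrightarrow> f k \<in> paths D (us ! k) (vs ! (\<pi> k))"
    and sh: "shared us f \<noteq> {}"
  shows "\<forall>k < length us. swap_tails us f k \<in> paths D (us ! k) (vs ! (swap_perm us f \<pi> k))"
    and "shared us (swap_tails us f) = shared us f"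
    and "crossing us (swap_tails us f) = crossing us f"
    and "swap_tails us (swap_tails us f) = f"
    and "(\<Prod>k<length us. path_wt x (swap_tails us f k)) = (\<Prod>k<length us. path_wt x (f k))"
proof -
  obtain w i j where c: "crossing us f = (w, i, j)" by (metis prod_cases3)
  note props = crossing_props[OF sh c]
  have ij: "i < length us" "j < length us" "i \<noteq> j"
    and wi: "w \<in> path_verts D (us ! i) (f i)" and wj: "w \<in> path_verts D (us ! j) (f j)"
    using props by (auto simp: occ_def)
  define a b p q where "a = path_before D w (f i)" and "b = path_after D w (f i)"
    and "p = path_before D w (f j)" and "q = path_after D w (f j)"
  have fi: "f i = a @ b" and fj: "f j = p @ q" by (simp_all add: a_def b_def p_def q_def)
  have a: "awalk (us ! i) a w" and b: "awalk w b (vs ! \<pi> i)"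
    using f[OF ij(1)] wi awalk_path_before_after unfolding a_def b_def paths_acyclic path_verts_def by blast+
  have p: "awalk (us ! j) p w" and q: "awalk w q (vs ! \<pi> j)"
    using f[OF ij(2)] wj awalk_path_before_after unfolding p_def q_def paths_acyclic path_verts_def by blast+
  let ?g = "swap_tails us f"
  have g: "?g = f(i := a @ q, j := p @ b)"
    unfolding swap_tails_def c a_def b_def p_def q_def by simp
  have gi: "?g i = a @ q" and gj: "?g j = p @ b" and gk: "\<And>k. k \<noteq> i \<Longrightarrow> k \<noteq> j \<Longrightarrow> ?g k = f k"
    using ij by (auto simp: g)
  show "\<forall>k < length us. ?g k \<in> paths D (us ! k) (vs ! (swap_perm us f \<pi> k))"
  proof (intro allI impI)
    fix k assume k: "k < length us"
    consider "k = i" | "k = j" | "k \<noteq> i" "k \<noteq> j" by blast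
    then show "?g k \<in> paths D (us ! k) (vs ! (swap_perm us f \<pi> k))"
    proof cases
      case 1
      then show ?thesis using awalk_appendI[OF a q] gi by (simp add: swap_perm_def c paths_acyclic)
    next
      case 2
      then show ?thesis using awalk_appendI[OF p b] gj by (simp add: swap_perm_def c paths_acyclic)
    next
      case 3
      then show ?thesis using f[OF k] gk by (simp add: swap_perm_def c transpose_def)
    qed
  qed
  have "path_verts D (us ! i) (f i) = path_verts D (us ! i) a \<union> path_verts D w b"
    "path_verts D (us ! j) (f j) = path_verts D (us ! j) p \<union> path_verts D w q"
    "path_verts D (us ! i) (?g i) = path_verts D (us ! i) a \<union> path_verts D w q"
    "path_verts D (us ! j) (?g j) = path_verts D (us ! j) p \<union> path_verts D w b"
    unfolding fi fj gi gj using path_verts_append a b p q by blast+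
  moreover have "path_verts D (us ! i) a \<inter> path_verts D w b \<subseteq> {w}"
    "path_verts D (us ! i) a \<inter> path_verts D w q \<subseteq> {w}"
    "path_verts D (us ! j) p \<inter> path_verts D w b \<subseteq> {w}"
    "path_verts D (us ! j) p \<inter> path_verts D w q \<subseteq> {w}"
    using path_verts_inter a b p q by blast+
  moreover have w_mem: "w \<in> path_verts D (us ! i) (?g i)" "w \<in> path_verts D (us ! j) (?g j)"
    unfolding gi gj using path_verts_append[OF a q] path_verts_append[OF p b] path_verts_ends a p
    by blast+
  \<comment> \<open>For \<open>y\<close> other than \<open>w\<close>, a head and a tail never share
    \<open>y\<close>, even if they come from different paths. So \<open>y\<close> lies on both paths
    exactly when it lies on both heads or on both tails, and this does not depend on how the tails
    are attached.\<close>
  ultimately have both: "y \<noteq> w \<Longrightarrow> y \<in> path_verts D (us ! i) (f i) \<and> y \<in> path_verts D (us ! j) (f j)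
        \<longleftrightarrow> y \<in> path_verts D (us ! i) (?g i) \<and> y \<in> path_verts D (us ! j) (?g j)"
    and either: "y \<in> path_verts D (us ! i) (f i) \<or> y \<in> path_verts D (us ! j) (f j)
        \<longleftrightarrow> y \<in> path_verts D (us ! i) (?g i) \<or> y \<in> path_verts D (us ! j) (?g j)" for y
    by blast+
  have other: "occ us ?g y - {i, j} = occ us f y - {i, j}" for y
    by (auto simp: occ_def gk)
  have occ_w: "occ us ?g w = occ us f w"
  proof -
    have "i \<in> occ us ?g w" "j \<in> occ us ?g w" using w_mem ij by (auto simp: occ_def)
    then show ?thesis using other[of w] props by blast
  qed
  \<comment> \<open>Having two distinct indices in \<open>S\<close> is expressed through the
    remaining indices and the two conditions on \<open>i\<close> and \<open>j\<close> that the
    exchange preserves.\<close>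
  have two: "(\<exists>k l. k \<noteq> l \<and> k \<in> S \<and> l \<in> S) \<longleftrightarrow> i \<in> S \<and> j \<in> S \<or> (i \<in> S \<or> j \<in> S) \<and> S - {i, j} \<noteq> {}
      \<or> (\<exists>k l. k \<noteq> l \<and> k \<in> S - {i, j} \<and> l \<in> S - {i, j})" for S :: "nat set"
    using \<open>i \<noteq> j\<close> by blast
  have sh_eq: "shared us ?g = shared us f"
  proof (rule Set.set_eqI)
    fix y
    show "y \<in> shared us ?g \<longleftrightarrow> y \<in> shared us f"
    proof (cases "y = w")
      case False
      have "i \<in> occ us ?g y \<and> j \<in> occ us ?g y \<longleftrightarrow> i \<in> occ us f y \<and> j \<in> occ us f y"
        "i \<in> occ us ?g y \<or> j \<in> occ us ?g y \<longleftrightarrow> i \<in> occ us f y \<or> j \<in> occ us f y"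
        using both[OF False] either[of y] ij by (simp_all add: occ_def)
      then show ?thesis
        unfolding shared_def mem_Collect_eq two[of "occ us ?g y"] two[of "occ us f y"] other by simp
    qed (simp add: shared_def occ_w)
  qed
  then show "shared us ?g = shared us f" .
  show c': "crossing us ?g = crossing us f"
    using c occ_w unfolding crossing_def sh_eq by (auto simp: Let_def)
  have ab: "path_before D w (?g i) = a" "path_after D w (?g i) = q"
    "path_before D w (?g j) = p" "path_after D w (?g j) = b"
    unfolding gi gj using path_before_after_append a b p q by blast+
  have "swap_tails us ?g = ?g(i := a @ b, j := p @ q)"
    unfolding swap_tails_def[of us ?g] c' c using ab by simp
  then show "swap_tails us ?g = f"
    unfolding g fi[symmetric] fj[symmetric] using ij by (auto simp: fun_eq_iff)
  show "(\<Prod>k<length us. path_wt x (?g k)) = (\<Prod>k<length us. path_wt x (f k))"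
  proof -
    have split: "(\<Prod>k<length us. path_wt x (e k))
        = path_wt x (e i) * (path_wt x (e j) * (\<Prod>k\<in>{..<length us} - {i} - {j}. path_wt x (e k)))"
      for e :: "nat \<Rightarrow> 'e list"
      using ij by (subst prod.remove[of _ i], simp, simp, subst prod.remove[of _ j]) auto
    have "(\<Prod>k\<in>{..<length us} - {i} - {j}. path_wt x (?g k))
        = (\<Prod>k\<in>{..<length us} - {i} - {j}. path_wt x (f k))"
      by (rule prod.cong) (auto simp: gk)
    then show ?thesis unfolding split gi gj fi fj by (simp add: path_wt_def mult_ac)
  qed
qed

text \<open>The predicate \<open>P\<close> singles out one element of each orbit, so that terms
  cancel in pairs. Showing merely that the sum equals its negative would not suffice where two is a
  zero divisor.\<close>

lemma sum_eq_0_by_involution: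
  fixes g :: "'b \<Rightarrow> 'c::comm_ring_1"
  assumes "finite X" "\<And>x. x \<in> X \<Longrightarrow> \<phi> x \<in> X" "\<And>x. x \<in> X \<Longrightarrow> \<phi> (\<phi> x) = x"
    and "\<And>x. x \<in> X \<Longrightarrow> P (\<phi> x) \<longleftrightarrow> \<not> P x" "\<And>x. x \<in> X \<Longrightarrow> g (\<phi> x) = - g x"
  shows "sum g X = 0"
proof -
  have "sum g X = sum g {x \<in> X. P x} + sum g {x \<in> X. \<not> P x}"
    using assms(1) by (subst sum.union_disjoint[symmetric]) (auto intro: sum.cong)
  also have "sum g {x \<in> X. \<not> P x} = (\<Sum>x\<in>{x \<in> X. P x}. - g x)"
    by (rule sum.reindex_bij_witness[of _ \<phi> \<phi>]) (use assms in auto)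
  finally show ?thesis by (simp add: sum_negf)
qed

lemma strict_mono_permutes_id:
  fixes \<pi> :: "nat \<Rightarrow> nat"
  assumes "\<pi> permutes {0..<n}" "\<And>i j. i < j \<Longrightarrow> j < n \<Longrightarrow> \<pi> i < \<pi> j"
  shows "\<pi> = id"
proof (rule permutes_natset_ge[OF assms(1)])
  have "i < n \<Longrightarrow> i \<le> \<pi> i" for i
  proof (induction i)
    case (Suc i)
    then show ?case using assms(2)[of i "Suc i"] by simp
  qed simp
  then show "\<forall>i\<in>{0..<n}. i \<le> \<pi> i" by simp
qed

text \<open>The determinant becomes a signed sum over pairs of a permutation and a family of paths.
  Families with a shared vertex cancel under the exchange of tails; the others form the defining sum
  of \<open>F0\<close>.\<close>

lemma lindstroem_gessel_viennot:
  fixes x :: "'e \<Rightarrow> 'a::comm_ring_1"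
  assumes fin: "finitely_many_paths D"
    and len: "length vs = length us"
    and verts: "set us \<subseteq> verts D" "set vs \<subseteq> verts D"
    and compat: "D_compatible D us vs"
  shows "det (H D x us vs) = F0 D x us vs"
proof -
  let ?n = "length us"
  let ?perms = "{\<pi>. \<pi> permutes {0..<?n}}"
  let ?fam = "\<lambda>\<pi>. PiE {..<?n} (\<lambda>k. paths D (us ! k) (vs ! \<pi> k))"
  let ?X = "SIGMA \<pi>:?perms. ?fam \<pi>"
  let ?t = "\<lambda>(\<pi>, f). signof \<pi> * (\<Prod>k<?n. path_wt x (f k))"
  have pi_less: "\<pi> k < ?n" if "\<pi> permutes {0..<?n}" "k < ?n" for \<pi> k
    using permutes_in_image[OF that(1), of k] that(2) by simp
  have fin_paths: "finite (paths D (us ! k) (vs ! \<pi> k))" if "\<pi> permutes {0..<?n}" "k < ?n" for \<pi> k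
    using fin verts pi_less[OF that] that(2) len unfolding finitely_many_paths_def
    by (metis nth_mem subsetD)
  have fin_perms: "finite ?perms" by (simp add: finite_permutations)
  have finX: "finite ?X"
    using fin_perms fin_paths by (intro finite_SigmaI finite_PiE) auto
  have "det (H D x us vs) = (\<Sum>\<pi>\<in>?perms. signof \<pi> * (\<Prod>k<?n. h D x (us ! k) (vs ! \<pi> k)))"
    using pi_less len by (auto simp: det_def H_def vmat_def atLeast0LessThan intro!: sum.cong prod.cong arg_cong2[where f="(*)"])
  also have "\<dots> = (\<Sum>\<pi>\<in>?perms. \<Sum>f\<in>?fam \<pi>. ?t (\<pi>, f))"
  proof (rule sum.cong)
    fix \<pi> assume "\<pi> \<in> ?perms"
    then have "(\<Prod>k<?n. h D x (us ! k) (vs ! \<pi> k)) = (\<Sum>f\<in>?fam \<pi>. \<Prod>k<?n. path_wt x (f k))"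
      unfolding h_def using fin_paths by (intro prod_sum_PiE) auto
    then show "signof \<pi> * (\<Prod>k<?n. h D x (us ! k) (vs ! \<pi> k)) = (\<Sum>f\<in>?fam \<pi>. ?t (\<pi>, f))"
      by (simp add: sum_distrib_left)
  qed simp
  also have "\<dots> = sum ?t ?X"
    using fin_perms fin_paths by (subst sum.Sigma) (auto intro!: finite_PiE)
  also have "\<dots> = sum ?t {(\<pi>, f) \<in> ?X. shared us f = {}} + sum ?t {(\<pi>, f) \<in> ?X. shared us f \<noteq> {}}"
  proof -
    let ?A = "{(\<pi>, f) \<in> ?X. shared us f = {}}" and ?B = "{(\<pi>, f) \<in> ?X. shared us f \<noteq> {}}"
    have "finite ?A" "finite ?B" by (rule finite_subset[OF _ finX], blast)+
    moreover have "?A \<inter> ?B = {}" "?X = ?A \<union> ?B" by blast+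
    ultimately show ?thesis by (metis (no_types, lifting) sum.union_disjoint)
  qed
  also have "sum ?t {(\<pi>, f) \<in> ?X. shared us f \<noteq> {}} = 0"
  proof (rule sum_eq_0_by_involution[where P = "\<lambda>(\<pi>, f). sign \<pi> = 1"
        and \<phi> = "\<lambda>(\<pi>, f). (swap_perm us f \<pi>, swap_tails us f)"])
    show "finite {(\<pi>, f) \<in> ?X. shared us f \<noteq> {}}"
      by (rule finite_subset[OF _ finX]) auto
    fix y assume "y \<in> {(\<pi>, f) \<in> ?X. shared us f \<noteq> {}}"
    then obtain \<pi> f where y: "y = (\<pi>, f)" and perm: "\<pi> permutes {0..<?n}" and f: "f \<in> ?fam \<pi>"
      and sh: "shared us f \<noteq> {}" by blast
    obtain w i j where c: "crossing us f = (w, i, j)" by (metis prod_cases3)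
    have ij: "i < ?n" "j < ?n" "i \<noteq> j" using crossing_props[OF sh c] by (auto simp: occ_def)
    have "f k \<in> paths D (us ! k) (vs ! \<pi> k)" if "k < ?n" for k using f that by auto
    note main = swap_tails_main[OF this sh]
    have perm': "swap_perm us f \<pi> permutes {0..<?n}"
      unfolding swap_perm_def c using ij perm by (auto intro!: permutes_compose permutes_swap_id)
    \<comment> \<open>Families are extensional functions, so their value outside the index range
      must stay \<open>undefined\<close>; only the indices \<open>i\<close> and \<open>j\<close>,
      both in range, are changed.\<close>
    have ext: "swap_tails us f k = undefined" if "\<not> k < ?n" for k
      using f that ij unfolding swap_tails_def c by (auto simp: PiE_def extensional_def)
    have sgn: "sign (swap_perm us f \<pi>) = - sign \<pi>"
      unfolding swap_perm_def c using ij perm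
      by (simp add: sign_compose sign_swap_id permutation_swap_id permutes_imp_permutation[OF finite_atLeastLessThan])
    show "(case y of (\<pi>, f) \<Rightarrow> (swap_perm us f \<pi>, swap_tails us f)) \<in> {(\<pi>, f) \<in> ?X. shared us f \<noteq> {}}"
      using y perm' main(1,2) sh ext by (auto simp: PiE_def extensional_def)
    show "(case case y of (\<pi>, f) \<Rightarrow> (swap_perm us f \<pi>, swap_tails us f) of (\<pi>, f) \<Rightarrow>
        (swap_perm us f \<pi>, swap_tails us f)) = y"
      using main(3,4) by (simp add: y swap_perm_def c comp_assoc)
    show "(case case y of (\<pi>, f) \<Rightarrow> (swap_perm us f \<pi>, swap_tails us f) of (\<pi>, f) \<Rightarrow> sign \<pi> = 1)
        \<longleftrightarrow> \<not> (case y of (\<pi>, f) \<Rightarrow> sign \<pi> = 1)"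
      using sgn by (simp add: y) (metis minus_minus one_neq_neg_one sign_cases)
    show "?t (case y of (\<pi>, f) \<Rightarrow> (swap_perm us f \<pi>, swap_tails us f)) = - ?t y"
      using sgn main(5)[of x] by (simp add: y)
  qed
  also have "sum ?t {(\<pi>, f) \<in> ?X. shared us f = {}} = sum ?t {(\<pi>, f). \<pi> = id \<and> f \<in> ?fam id \<and> shared us f = {}}"
  proof (rule sum.cong)
    have "\<pi> = id" if perm: "\<pi> permutes {0..<?n}" and f: "f \<in> ?fam \<pi>" and sh: "shared us f = {}" for \<pi> f
    proof (rule strict_mono_permutes_id[OF perm], rule ccontr)
      fix i j assume ij: "i < j" "j < ?n" and "\<not> \<pi> i < \<pi> j"
      moreover have "\<pi> i \<noteq> \<pi> j" using injD[OF permutes_inj[OF perm], of i j] ij by auto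
      ultimately have "\<pi> j < \<pi> i" by linarith
      moreover have "f i \<in> paths D (us ! i) (vs ! \<pi> i)" "f j \<in> paths D (us ! j) (vs ! \<pi> j)"
        using PiE_mem[OF f, of i] PiE_mem[OF f, of j] ij by simp_all
      moreover have "\<pi> i < length vs" using pi_less[OF perm, of i] ij len by simp
      ultimately have "path_verts D (us ! i) (f i) \<inter> path_verts D (us ! j) (f j) \<noteq> {}"
        using compat[unfolded D_compatible_def, rule_format, OF ij, of "\<pi> j" "\<pi> i" "f i" "f j"]
        by blast
      then obtain w where "w \<in> path_verts D (us ! i) (f i)" "w \<in> path_verts D (us ! j) (f j)" by blast
      then have "i \<in> occ us f w" "j \<in> occ us f w" using ij by (auto simp: occ_def)
      then have "w \<in> shared us f"
        unfolding shared_def mem_Collect_eq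
        by (intro exI[of _ i] exI[of _ j]) (use ij in simp)
      then show False using sh by blast
    qed
    then show "{(\<pi>, f) \<in> ?X. shared us f = {}} = {(\<pi>, f). \<pi> = id \<and> f \<in> ?fam id \<and> shared us f = {}}"
      using permutes_id[of "{0..<?n}"] by blast
  qed simp
  also have "\<dots> = F0 D x us vs"
    unfolding F0_def
  proof (rule sum.reindex_bij_witness[of _ "\<lambda>ps. (id, \<lambda>k. if k < ?n then ps ! k else undefined)" "\<lambda>(\<pi>, f). map f [0..<?n]"])
    fix y assume "y \<in> {(\<pi>, f). \<pi> = (id :: nat \<Rightarrow> nat) \<and> f \<in> ?fam id \<and> shared us f = {}}"
    then obtain f where y: "y = (id, f)" and f: "f \<in> ?fam id" and sh: "shared us f = {}" by auto
    show "(id, \<lambda>k. if k < ?n then (case y of (\<pi>, f) \<Rightarrow> map f [0..<?n]) ! k else undefined) = y"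
      using f by (auto simp: y fun_eq_iff PiE_def extensional_def)
    have "path_verts D (us ! i) (f i) \<inter> path_verts D (us ! j) (f j) = {}"
      if "i < ?n" "j < ?n" "i \<noteq> j" for i j
      using sh that unfolding shared_def occ_def by blast
    then show "(case y of (\<pi>, f) \<Rightarrow> map f [0..<?n]) \<in> nonintersecting_rpaths D us vs"
      using f len by (auto simp: y nonintersecting_rpaths_def)
    show "(\<Prod>p\<leftarrow>(case y of (\<pi>, f) \<Rightarrow> map f [0..<?n]). path_wt x p) = ?t y"
      by (simp add: y comp_def prod.distinct_set_conv_list[symmetric] atLeast0LessThan)
  next
    fix ps assume ps: "ps \<in> nonintersecting_rpaths D us vs"
    then show "(case (id :: nat \<Rightarrow> nat, \<lambda>k. if k < ?n then ps ! k else undefined) of (\<pi>, f) \<Rightarrow> map f [0..<?n]) = ps"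
      by (auto simp: nonintersecting_rpaths_def intro: nth_equalityI)
    show "(id :: nat \<Rightarrow> nat, \<lambda>k. if k < ?n then ps ! k else undefined) \<in> {(\<pi>, f). \<pi> = id \<and> f \<in> ?fam id \<and> shared us f = {}}"
    proof -
      have "shared us (\<lambda>k. if k < ?n then ps ! k else undefined) = {}"
        using ps unfolding nonintersecting_rpaths_def shared_def occ_def by auto blast
      then show ?thesis using ps by (auto simp: nonintersecting_rpaths_def split: if_splits)
    qed
  qed
  finally show ?thesis by simp
qed

end

section \<open>Pfaffians of matrices\<close>

text \<open>The tags keep row and column indices apart, since the same vertex may occur among
  both.\<close>

definition bipartite :: "('u \<Rightarrow> 'v \<Rightarrow> 'a::comm_ring_1) \<Rightarrow> 'u + 'v \<Rightarrow> 'u + 'v \<Rightarrow> 'a" where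
  "bipartite q s t = (case (s, t) of (Inl u, Inr v) \<Rightarrow> q u v | (Inr v, Inl u) \<Rightarrow> - q u v | _ \<Rightarrow> 0)"

lemma bipartite_simps [simp]:
  "bipartite q (Inl u) (Inr v) = q u v" "bipartite q (Inr v) (Inl u) = - q u v"
  "bipartite q (Inl u) (Inl u') = 0" "bipartite q (Inr v) (Inr v') = 0"
  by (simp_all add: bipartite_def)

lemma pf_eq_0:
  assumes "\<And>x y. x \<in> set xs \<Longrightarrow> y \<in> set xs \<Longrightarrow> a x y = 0" "xs \<noteq> []"
  shows "pf a xs = 0"
  using assms by (cases xs) (auto intro!: sum.neutral)

lemma det_vmat_Cons:
  assumes "length ys = Suc (length xs)"
  shows "det (vmat q (x # xs) ys)
    = (\<Sum>j<length ys. (-1) ^ j * q x (ys ! j) * det (vmat q xs (remove_nth j ys)))"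
proof -
  let ?A = "vmat q (x # xs) ys"
  have A: "?A \<in> carrier_mat (length ys) (length ys)" using assms by (simp add: vmat_def)
  have "mat_delete ?A 0 j = vmat q xs (remove_nth j ys)" if "j < length ys" for j
    using that assms by (auto simp: mat_delete_def vmat_def remove_nth_def nth_append intro!: eq_matI)
  then have "(\<Sum>j<length ys. ?A $$ (0, j) * cofactor ?A 0 j)
      = (\<Sum>j<length ys. (-1) ^ j * q x (ys ! j) * det (vmat q xs (remove_nth j ys)))"
    by (intro sum.cong) (auto simp: cofactor_def vmat_def)
  moreover have "det ?A = (\<Sum>j<length ys. ?A $$ (0, j) * cofactor ?A 0 j)"
    using assms by (intro laplace_expansion_row[OF A]) auto
  ultimately show ?thesis by simp
qed

lemma sum_lessThan_add:
  fixes f :: "nat \<Rightarrow> 'a::comm_monoid_add"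
  shows "(\<Sum>i<m + n. f i) = (\<Sum>i<m. f i) + (\<Sum>i<n. f (m + i))"
  by (induction n) (auto simp: add.assoc)

text \<open>A head \<open>Inl x\<close> pairs only with columns. With the columns reversed, column
  \<open>j\<close> is met with exponent \<open>?m + (?n - Suc j)\<close>; if there is one column
  more than remaining rows, this has the parity of \<open>j\<close>, and the recursion is the
  Laplace expansion along the first row.\<close>

lemma pf_bipartite:
  fixes q :: "'u \<Rightarrow> 'v \<Rightarrow> 'a::comm_ring_1"
  shows "pf (bipartite q) (map Inl xs @ map Inr (rev ys))
    = (if length xs = length ys then det (vmat q xs ys) else 0)"
proof (induction xs arbitrary: ys)
  case Nil
  show ?case
  proof (cases "ys = []")
    case True
    then show ?thesis by (simp add: vmat_def det_def)
  qed (auto intro!: pf_eq_0)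
next
  case (Cons x xs)
  let ?m = "length xs" and ?n = "length ys"
  let ?p = "\<lambda>zs. pf (bipartite q) (map Inl xs @ map Inr (rev zs))"
  let ?L = "map Inl xs @ map Inr (rev ys)"
  have "pf (bipartite q) (map Inl (x # xs) @ map Inr (rev ys))
      = (\<Sum>i<?m + ?n. (-1) ^ i * bipartite q (Inl x) (?L ! i) * pf (bipartite q) (remove_nth i ?L))"
    by simp
  also have "\<dots> = (\<Sum>i<?n. (-1) ^ (?m + i) * q x (rev ys ! i) * ?p (remove_nth (?n - Suc i) ys))"
  proof -
    have "(\<Sum>i<?m. (-1) ^ i * bipartite q (Inl x) (?L ! i) * pf (bipartite q) (remove_nth i ?L)) = 0"
      by (rule sum.neutral) (simp add: nth_append)
    moreover have "remove_nth (?m + i) ?L = map Inl xs @ map Inr (rev (remove_nth (?n - Suc i) ys))"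
      if "i < ?n" for i
    proof -
      have "remove_nth (?m + i) ?L = map Inl xs @ remove_nth i (map Inr (rev ys))"
        by (simp add: remove_nth_def)
      then show ?thesis using that by (simp add: remove_nth_map remove_nth_rev)
    qed
    ultimately show ?thesis
      unfolding sum_lessThan_add by (auto intro!: sum.cong simp: nth_append)
  qed
  also have "\<dots> = (\<Sum>j<?n. (-1) ^ (?m + (?n - Suc j)) * q x (ys ! j) * ?p (remove_nth j ys))"
    by (rule sum.reindex_bij_witness[of _ "\<lambda>i. ?n - Suc i" "\<lambda>i. ?n - Suc i"]) (auto simp: rev_nth)
  also have "\<dots> = (if length (x # xs) = ?n then det (vmat q (x # xs) ys) else 0)"
  proof (cases "?n = Suc ?m")
    case True
    have "(-1) ^ (?m + (?n - Suc j)) = ((-1) ^ j :: 'a)" if "j < ?n" for j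
    proof -
      have "even (?m + (?n - Suc j)) \<longleftrightarrow> even j" using that True by (auto simp: Suc_diff_le)
      then show ?thesis by (simp add: minus_one_power_iff)
    qed
    then show ?thesis
      using True by (simp only: det_vmat_Cons) (auto intro!: sum.cong simp: Cons.IH)
  next
    case False
    then show ?thesis by (auto intro!: sum.neutral simp: Cons.IH)
  qed
  finally show ?case .
qed

section \<open>The Pfaffian of a matrix as a signed sum over perfect matchings\<close>

definition matchings :: "nat \<Rightarrow> (nat \<Rightarrow> nat) set" where
  "matchings n = {\<sigma>. \<sigma> permutes {0..<2 * n} \<and> (\<forall>i<n. \<sigma> (2 * i) < \<sigma> (2 * i + 1)) \<and>
    (\<forall>i<n. \<forall>j<n. i < j \<longrightarrow> \<sigma> (2 * i) < \<sigma> (2 * j))}"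

text \<open>The matching that pairs 0 with \<open>Suc j\<close> and transports \<tau> to the other
  points. Two insertions into a permutation are used because the sign of each insertion is
  known.\<close>

definition add_pair :: "nat \<Rightarrow> (nat \<Rightarrow> nat) \<Rightarrow> nat \<Rightarrow> nat" where
  "add_pair j \<tau> = permutation_insert 0 0 (permutation_insert 0 j \<tau>)"

text \<open>The increasing enumeration of the numbers other than 0 and \<open>Suc j\<close>.\<close>

definition skip_pair :: "nat \<Rightarrow> nat \<Rightarrow> nat" where
  "skip_pair j i = Suc (if i < j then i else Suc i)"

lemma add_pair_simps [simp]:
  "add_pair j \<tau> 0 = 0" "add_pair j \<tau> (Suc 0) = Suc j"
  "add_pair j \<tau> (Suc (Suc i)) = skip_pair j (\<tau> i)"
  by (auto simp: add_pair_def permutation_insert_expand skip_pair_def)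

lemma skip_pair_less [simp]: "skip_pair j i < skip_pair j k \<longleftrightarrow> i < k"
  by (auto simp: skip_pair_def)

lemma skip_pair_pos [simp]: "0 < skip_pair j i"
  by (simp add: skip_pair_def)

lemma add_pair_permutes:
  assumes "\<tau> permutes {0..<2 * n}" "j \<le> 2 * n"
  shows "add_pair j \<tau> permutes {0..<2 * Suc n}"
  using permutation_insert_permutes[OF permutation_insert_permutes[OF assms(1), of 0 j], of 0 0] assms(2)
  by (simp add: add_pair_def)

lemma sign_add_pair:
  assumes "\<tau> permutes {0..<2 * n}" "j \<le> 2 * n"
  shows "of_int (sign (add_pair j \<tau>)) = ((-1) ^ j * of_int (sign \<tau>) :: 'a::comm_ring_1)"
  using signof_permutation_insert[OF assms(1), of 0 j, where 'a='a] assms(2)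
    signof_permutation_insert[OF permutation_insert_permutes[OF assms(1), of 0 j], of 0 0, where 'a='a]
  by (simp add: add_pair_def)

lemma inj_add_pair: "add_pair j \<tau> = add_pair j' \<tau>' \<Longrightarrow> j = j' \<and> \<tau> = \<tau>'"
proof -
  assume eq: "add_pair j \<tau> = add_pair j' \<tau>'"
  have j: "j = j'" using fun_cong[OF eq, of "Suc 0"] by simp
  have "\<tau> i = \<tau>' i" for i
    using fun_cong[OF eq, of "Suc (Suc i)"] skip_pair_less[of j "\<tau> i" "\<tau>' i"]
      skip_pair_less[of j "\<tau>' i" "\<tau> i"] unfolding j by (simp del: skip_pair_less)
  then show ?thesis using j by auto
qed

lemma all_less_Suc_shift: "(\<forall>i<Suc n. P i) \<longleftrightarrow> P 0 \<and> (\<forall>i<n. P (Suc i))"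
  by (auto simp: less_Suc_eq_0_disj)

lemma add_pair_matching_iff:
  "(\<forall>i<Suc n. add_pair j \<tau> (2 * i) < add_pair j \<tau> (2 * i + 1)) \<and>
    (\<forall>i<Suc n. \<forall>k<Suc n. i < k \<longrightarrow> add_pair j \<tau> (2 * i) < add_pair j \<tau> (2 * k)) \<longleftrightarrow>
   (\<forall>i<n. \<tau> (2 * i) < \<tau> (2 * i + 1)) \<and> (\<forall>i<n. \<forall>k<n. i < k \<longrightarrow> \<tau> (2 * i) < \<tau> (2 * k))"
  unfolding all_less_Suc_shift by simp

text \<open>The partner of 0 can be any of the other points, and removing this pair leaves a
  normalised matching; summed over, this is the expansion along the first row.\<close>

lemma matchings_Suc:
  "matchings (Suc n) = (\<lambda>(j, \<tau>). add_pair j \<tau>) ` ({..<Suc (2 * n)} \<times> matchings n)"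
proof (intro equalityI subsetI)
  fix \<sigma> assume "\<sigma> \<in> matchings (Suc n)"
  then have perm: "\<sigma> permutes {0..<Suc (Suc (2 * n))}"
    and pairs: "\<And>i. i < Suc n \<Longrightarrow> \<sigma> (2 * i) < \<sigma> (2 * i + 1)"
    and firsts: "\<And>i j. i < Suc n \<Longrightarrow> j < Suc n \<Longrightarrow> i < j \<Longrightarrow> \<sigma> (2 * i) < \<sigma> (2 * j)"
    by (auto simp: matchings_def)
  have "0 \<in> \<sigma> ` {0..<Suc (Suc (2 * n))}" using permutes_image[OF perm] by simp
  then obtain p where p: "p < Suc (Suc (2 * n))" "\<sigma> p = 0" by auto
  \<comment> \<open>The normalisation puts 0 first: at an odd position it would exceed its partner,
    at a later even position it would exceed the first entry of the first pair.\<close>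
  have "p = 0"
  proof (cases "even p")
    case True
    then obtain i where "p = 2 * i" by auto
    then show ?thesis using firsts[of 0 i] p by (cases "i = 0") auto
  next
    case False
    then obtain i where "p = 2 * i + 1" by (auto elim: oddE)
    then show ?thesis using pairs[of i] p by auto
  qed
  then have "\<sigma> \<in> {q. q permutes {0..<Suc (Suc (2 * n))} \<and> q 0 = 0}" using p perm by simp
  then obtain \<rho> where \<rho>: "\<sigma> = permutation_insert 0 0 \<rho>" "\<rho> permutes {0..<Suc (2 * n)}"
    using permutation_fix[of 0 "Suc (2 * n)" 0] by auto
  have j: "\<rho> 0 < Suc (2 * n)" using permutes_in_image[OF \<rho>(2), of 0] by simp
  then have "\<rho> \<in> {q. q permutes {0..<Suc (2 * n)} \<and> q 0 = \<rho> 0}" using \<rho> by simp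
  then obtain \<tau> where \<tau>: "\<rho> = permutation_insert 0 (\<rho> 0) \<tau>" "\<tau> permutes {0..<2 * n}"
    using permutation_fix[of 0 "2 * n" "\<rho> 0"] j by auto
  have \<sigma>: "\<sigma> = add_pair (\<rho> 0) \<tau>" unfolding add_pair_def using \<rho>(1) \<tau>(1) by simp
  have "\<tau> \<in> matchings n"
    using add_pair_matching_iff[of n "\<rho> 0" \<tau>] pairs firsts \<tau>(2) unfolding \<sigma>[symmetric] matchings_def
    by blast
  then show "\<sigma> \<in> (\<lambda>(j, \<tau>). add_pair j \<tau>) ` ({..<Suc (2 * n)} \<times> matchings n)"
    using \<sigma> j by blast
next
  fix \<sigma> assume "\<sigma> \<in> (\<lambda>(j, \<tau>). add_pair j \<tau>) ` ({..<Suc (2 * n)} \<times> matchings n)"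
  then obtain j \<tau> where *: "\<sigma> = add_pair j \<tau>" "j \<le> 2 * n" "\<tau> \<in> matchings n" by auto
  then show "\<sigma> \<in> matchings (Suc n)"
    using add_pair_matching_iff[of n j \<tau>] add_pair_permutes[of \<tau> n j] unfolding matchings_def *(1)
    by blast
qed

lemma sum_matchings_eq_pf:
  fixes a :: "nat \<Rightarrow> nat \<Rightarrow> 'a::comm_ring_1"
  shows "(\<Sum>\<sigma>\<in>matchings n. of_int (sign \<sigma>) * (\<Prod>i<n. a (\<sigma> (2 * i)) (\<sigma> (2 * i + 1)))) = pf a [0..<2 * n]"
proof (induction n arbitrary: a)
  case 0
  have "matchings 0 = {id}" by (auto simp: matchings_def)
  then show ?case by simp
next
  case (Suc n)
  let ?t = "\<lambda>n a \<sigma>. of_int (sign \<sigma>) * (\<Prod>i<n. a (\<sigma> (2 * i)) (\<sigma> (2 * i + 1))) :: 'a"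
  have fin: "finite (matchings n)"
    by (rule finite_subset[OF _ finite_permutations[of "{0..<2 * n}"]]) (auto simp: matchings_def)
  have "sum (?t (Suc n) a) (matchings (Suc n))
      = (\<Sum>(j, \<tau>)\<in>{..<Suc (2 * n)} \<times> matchings n. ?t (Suc n) a (add_pair j \<tau>))"
    unfolding matchings_Suc
    by (subst sum.reindex) (auto intro!: inj_onI sum.cong dest: inj_add_pair)
  also have "\<dots> = (\<Sum>j<Suc (2 * n). \<Sum>\<tau>\<in>matchings n. ?t (Suc n) a (add_pair j \<tau>))"
    using fin by (subst sum.cartesian_product) simp
  also have "\<dots> = (\<Sum>j<Suc (2 * n). (-1) ^ j * a 0 (Suc j) * pf a (map (skip_pair j) [0..<2 * n]))"
  proof (rule sum.cong)
    fix j assume j: "j \<in> {..<Suc (2 * n)}"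
    have "(\<Sum>\<tau>\<in>matchings n. ?t (Suc n) a (add_pair j \<tau>))
        = (\<Sum>\<tau>\<in>matchings n. (-1) ^ j * a 0 (Suc j) * ?t n (\<lambda>u v. a (skip_pair j u) (skip_pair j v)) \<tau>)"
    proof (rule sum.cong)
      fix \<tau> assume "\<tau> \<in> matchings n"
      then have "of_int (sign (add_pair j \<tau>)) = ((-1) ^ j * of_int (sign \<tau>) :: 'a)"
        using j by (intro sign_add_pair) (auto simp: matchings_def)
      then show "?t (Suc n) a (add_pair j \<tau>)
          = (-1) ^ j * a 0 (Suc j) * ?t n (\<lambda>u v. a (skip_pair j u) (skip_pair j v)) \<tau>"
        by (simp add: prod.lessThan_Suc_shift mult_ac del: prod.lessThan_Suc)
    qed simp
    also have "\<dots> = (-1) ^ j * a 0 (Suc j) * pf a (map (skip_pair j) [0..<2 * n])"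
      unfolding sum_distrib_left[symmetric] pf_map
        Suc.IH[of "\<lambda>u v. a (skip_pair j u) (skip_pair j v)"] ..
    finally show "(\<Sum>\<tau>\<in>matchings n. ?t (Suc n) a (add_pair j \<tau>))
        = (-1) ^ j * a 0 (Suc j) * pf a (map (skip_pair j) [0..<2 * n])" .
  qed simp
  also have "\<dots> = pf a (0 # [1..<2 * Suc n])"
  proof -
    have "remove_nth j [1..<2 * Suc n] = map (skip_pair j) [0..<2 * n]" if "j < Suc (2 * n)" for j
      using that by (intro nth_equalityI) (auto simp: remove_nth_def nth_append skip_pair_def)
    then show ?thesis by (simp del: upt_Suc)
  qed
  also have "0 # [1..<2 * Suc n] = [0..<2 * Suc n]" by (simp add: upt_rec[of 0] del: upt_Suc)
  finally show ?case .
qed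

lemma Pf_eq_pf:
  assumes "even (dim_row A)"
  shows "Pf A = pf (\<lambda>i j. A $$ (i, j)) [0..<dim_row A]"
  using sum_matchings_eq_pf[where n = "dim_row A div 2" and a = "\<lambda>i j. A $$ (i, j)"] assms
  by (simp add: Pf_def Let_def matchings_def atLeast0LessThan)

lemma Pf_vmat:
  assumes "even (length X)"
  shows "Pf (vmat a X X) = pf a X"
proof -
  have "pf (\<lambda>i j. vmat a X X $$ (i, j)) [0..<length X] = pf (\<lambda>i j. a (X ! i) (X ! j)) [0..<length X]"
    by (rule pf_cong) (auto simp: vmat_def)
  also have "\<dots> = pf a (map ((!) X) [0..<length X])" by (rule pf_map[symmetric])
  finally show ?thesis using Pf_eq_pf[of "vmat a X X"] assms by (simp add: vmat_def map_nth)
qed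

text \<open>The element picked at \<open>k\<close> is the member of the set with exactly
  \<open>k\<close> smaller members, so it suffices to count below the claimed value. The second
  threshold is tested after the shift caused by skipping \<open>i\<close>.\<close>

lemma pick_Compl_two:
  assumes "i < j"
  shows "pick (- {i, j}) k = (if k < i then k else if Suc k < j then Suc k else Suc (Suc k))"
    (is "_ = ?q")
proof -
  have "{a \<in> - {i, j}. a < ?q} = {..<?q} - {i, j}" by auto
  moreover have "card ({..<?q} - {i, j}) = k"
    using assms by (auto simp: card_Diff_subset_Int Int_insert_right)
  moreover have "?q \<in> - {i, j}" using assms by auto
  ultimately show ?thesis using pick_card_in_set[of ?q "- {i, j}"] by simp
qed

lemma copfaffian_entry:
  assumes "dim_row A = n" "dim_col A = n" "even n" "i < j" "j < n"
  shows "copfaffian A $$ (i, j)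
    = (-1) ^ (i + j + 1) * pf (\<lambda>k l. A $$ (k, l)) (remove_nth i (remove_nth j [0..<n]))"
proof -
  let ?S = "submatrix A (- {i, j}) (- {i, j})"
  have "{k. k < n \<and> k \<in> - {i, j}} = {..<n} - {i, j}" by auto
  then have card: "card {k. k < n \<and> k \<in> - {i, j}} = n - 2"
    using assms by (simp add: card_Diff_subset)
  then have dims: "dim_row ?S = n - 2" "dim_col ?S = n - 2"
    using assms by (simp_all add: dim_submatrix)
  have "Pf ?S = pf (\<lambda>k l. ?S $$ (k, l)) [0..<n - 2]"
    using Pf_eq_pf[of ?S] assms(3) dims by simp
  also have "\<dots> = pf (\<lambda>k l. A $$ (pick (- {i, j}) k, pick (- {i, j}) l)) [0..<n - 2]"
    by (rule pf_cong) (use card assms in \<open>auto simp: submatrix_index\<close>)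
  also have "\<dots> = pf (\<lambda>k l. A $$ (k, l)) (map (pick (- {i, j})) [0..<n - 2])"
    by (rule pf_map[symmetric])
  also have "map (pick (- {i, j})) [0..<n - 2] = remove_nth i (remove_nth j [0..<n])"
    using assms by (intro nth_equalityI) (auto simp: pick_Compl_two remove_nth_def nth_append)
  finally show ?thesis using assms by (simp add: copfaffian_def Let_def)
qed

section \<open>Inverses, copfaffians and block matrices\<close>

text \<open>Coordinate one-forms anticommute and have square zero, and
  \<open>wedge_deltas_pf\<close> transfers this to \<open>p\<close>. The zero diagonal thus comes
  out in characteristic two as well.\<close>

lemma pf_inverse_alternating:
  fixes a p :: "'i \<Rightarrow> 'i \<Rightarrow> 'a::comm_ring_1"
  assumes a: "alternating_fun a"
    and inv: "\<And>y w. y \<in> set L \<Longrightarrow> w \<in> set L \<Longrightarrow> (\<Sum>z\<in>set L. p y z * a z w) = - of_bool (w = y)"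
    and "y \<in> set L" "w \<in> set L"
  shows "p y w * pf a L = - (p w y * pf a L)" "p y y * pf a L = 0"
proof -
  have two: "p y w * pf a L = wedge (wedge (delta y) (delta w)) (pf a) L"
    if "y \<in> set L" "w \<in> set L" for y w
    using wedge_deltas_pf[OF a inv, of "[y, w]"] that by (simp add: remove_nth_def wedge_assoc)
  have "wedge (delta y) (delta w) = (\<lambda>l. - wedge (delta w) (delta y :: 'i list \<Rightarrow> 'a) l)"
    unfolding delta_def by (subst wedge_one_form_commute) (simp add: twist_one_form fun_eq_iff wedge_minus_left)
  then show "p y w * pf a L = - (p w y * pf a L)"
    using assms(3,4) by (simp add: two wedge_minus_left)
  show "p y y * pf a L = 0"
    using assms(3) by (simp add: two delta_def wedge_one_form_self)
qed

text \<open>Entries above the diagonal come from \<open>pf_remove_two\<close>; the rest follows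
  because both sides are alternating.\<close>

lemma copfaffian_eq_inverse:
  fixes a p :: "'i \<Rightarrow> 'i \<Rightarrow> 'a::field"
  assumes a: "alternating_fun a" and L: "distinct L" "even (length L)"
    and inv: "\<And>y w. y \<in> set L \<Longrightarrow> w \<in> set L \<Longrightarrow> (\<Sum>z\<in>set L. p y z * a z w) = - of_bool (w = y)"
    and ij: "i < length L" "j < length L"
  shows "1 / pf a L * copfaffian (vmat a L L) $$ (i, j) = p (L ! i) (L ! j)"
proof -
  have nz: "pf a L \<noteq> 0" using pf_mult_pf_inverse[OF a L(1) inv] by auto
  let ?A = "vmat a L L"
  have upper: "copfaffian ?A $$ (i, j) = p (L ! i) (L ! j) * pf a L"
    if "i < j" "j < length L" for i j
  proof -
    let ?xs = "remove_nth i (remove_nth j [0..<length L])"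
    have "set ?xs \<subseteq> {0..<length L}"
      using set_remove_nth_subset[of i "remove_nth j [0..<length L]"]
        set_remove_nth_subset[of j "[0..<length L]"] by auto
    then have "pf (\<lambda>k l. ?A $$ (k, l)) ?xs = pf (\<lambda>k l. a (L ! k) (L ! l)) ?xs"
      by (intro pf_cong) (auto simp: vmat_def subset_iff)
    also have "\<dots> = pf a (remove_nth i (remove_nth j (map ((!) L) [0..<length L])))"
      by (simp only: pf_map remove_nth_map)
    also have "map ((!) L) [0..<length L] = L" by (rule map_nth)
    finally have "copfaffian ?A $$ (i, j) = (-1) ^ (i + j + 1) * pf a (remove_nth i (remove_nth j L))"
      using copfaffian_entry[of ?A "length L" i j] L that by (simp add: vmat_def)
    then show ?thesis using pf_remove_two[OF a L(1) inv that] by simp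
  qed
  have skew: "copfaffian ?A $$ (i, j) = - copfaffian ?A $$ (j, i)" if "j < i"
    using that ij by (simp add: copfaffian_def Let_def vmat_def insert_commute add.commute)
  have "copfaffian ?A $$ (i, j) = p (L ! i) (L ! j) * pf a L"
  proof (cases i j rule: linorder_cases)
    case less
    then show ?thesis using upper ij by simp
  next
    case equal
    then show ?thesis
      using pf_inverse_alternating(2)[OF a inv, of "L ! i" "L ! i"] ij by (simp add: copfaffian_def vmat_def)
  next
    case greater
    then show ?thesis
      using skew upper[of j i] pf_inverse_alternating(1)[OF a inv, of "L ! i" "L ! j"] ij by simp
  qed
  then show ?thesis using nz by simp
qed

text \<open>In the theorem \<open>a\<close> and \<open>b\<close> are constrained only on the listed
  vertices, whereas \<open>alternating_fun\<close> is a condition on all arguments; extension by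
  zero bridges the two.\<close>

definition restrict_to :: "'v set \<Rightarrow> ('v \<Rightarrow> 'v \<Rightarrow> 'a::zero) \<Rightarrow> 'v \<Rightarrow> 'v \<Rightarrow> 'a" where
  "restrict_to X a u v = (if u \<in> X \<and> v \<in> X then a u v else 0)"

lemma vmat_restrict_to:
  "set Y \<subseteq> X \<Longrightarrow> vmat (restrict_to X a) Y Y = vmat a Y Y"
  by (auto simp: vmat_def restrict_to_def intro!: eq_matI) (metis nth_mem subsetD)+

lemma alternating_fun_restrict_to:
  fixes a :: "'v \<Rightarrow> 'v \<Rightarrow> 'a::comm_ring_1"
  assumes "skew_symmetric_mat (vmat a L L)"
  shows "alternating_fun (restrict_to (set L) a)"
proof -
  have "a (L ! j) (L ! i) = - a (L ! i) (L ! j)" if "i < length L" "j < length L" for i j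
  proof -
    have "transpose_mat (vmat a L L) $$ (i, j) = (- vmat a L L) $$ (i, j)"
      using assms by (simp add: skew_symmetric_mat_def)
    then show ?thesis using that by (simp add: vmat_def)
  qed
  moreover have "a (L ! i) (L ! i) = 0" if "i < length L" for i
    using assms that by (simp add: skew_symmetric_mat_def vmat_def)
  ultimately have swap: "a u v = - a v u" and diag: "a u u = 0"
    if "u \<in> set L" "v \<in> set L" for u v
    using that unfolding in_set_conv_nth by blast+
  have "restrict_to (set L) a u v = - restrict_to (set L) a v u" for u v
    using swap[of u v] by (cases "u \<in> set L \<and> v \<in> set L") (auto simp: restrict_to_def)
  moreover have "restrict_to (set L) a u u = 0" for u
    using diag by (simp add: restrict_to_def)
  ultimately show ?thesis unfolding alternating_fun_def by blast
qed

text \<open>Minus the inverse matrix, transported from positions to vertices. The zero values off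
  the list later supply the zero blocks belonging to \<open>R0\<close> and
  \<open>S0\<close>.\<close>

lemma ex_inverse_function:
  fixes a :: "'v \<Rightarrow> 'v \<Rightarrow> 'a::comm_ring_1"
  assumes L: "distinct L" and inv: "invertible_mat (vmat a L L)"
  obtains p where "\<And>y w. y \<in> set L \<Longrightarrow> w \<in> set L \<Longrightarrow> (\<Sum>z\<in>set L. p y z * a z w) = - of_bool (w = y)"
    and "\<And>u v. u \<notin> set L \<or> v \<notin> set L \<Longrightarrow> p u v = 0"
proof -
  let ?A = "vmat a L L" and ?n = "length L"
  obtain B where B: "inverts_mat B ?A" "inverts_mat ?A B" using inv by (auto simp: invertible_mat_def)
  \<comment> \<open>\<open>inverts_mat\<close> does not prescribe the shape of \<open>B\<close>;
    comparing both products with identity matrices forces it.\<close>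
  have "dim_col (?A * B) = ?n" "dim_row (?A * B) = dim_row ?A" "dim_row (B * ?A) = dim_row B"
      "dim_col (B * ?A) = dim_row B"
    using B by (simp_all add: inverts_mat_def vmat_def)
  then have dimB: "dim_row B = ?n" "dim_col B = ?n" by (simp_all add: vmat_def)
  define idx where "idx = inv_into {..<?n} ((!) L)"
  have bij: "bij_betw ((!) L) {..<?n} (set L)" by (rule bij_betw_nth) (use L in auto)
  have idx: "idx (L ! i) = i" if "i < ?n" for i
    unfolding idx_def using bij that by (auto simp: bij_betw_def)
  define p where "p u v = (if u \<in> set L \<and> v \<in> set L then - (B $$ (idx u, idx v)) else 0)" for u v
  have "(\<Sum>z\<in>set L. p y z * a z w) = - of_bool (w = y)" if yw: "y \<in> set L" "w \<in> set L" for y w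
  proof -
    obtain i j where i: "i < ?n" "y = L ! i" and j: "j < ?n" "w = L ! j"
      using yw by (metis in_set_conv_nth)
    have "(\<Sum>z\<in>set L. p y z * a z w) = (\<Sum>k<?n. p y (L ! k) * a (L ! k) w)"
      by (rule sum.reindex_bij_betw[OF bij, symmetric])
    also have "\<dots> = (\<Sum>k<?n. - (B $$ (i, k) * ?A $$ (k, j)))"
      using i j by (intro sum.cong) (auto simp: p_def idx vmat_def)
    also have "\<dots> = - (B * ?A) $$ (i, j)"
      using i j dimB by (simp add: scalar_prod_def atLeast0LessThan sum_negf vmat_def)
    also have "B * ?A = 1\<^sub>m ?n" using B(1) dimB by (simp add: inverts_mat_def)
    finally show ?thesis using i j L by (auto simp: nth_eq_iff_index_eq)
  qed
  then show ?thesis by (rule that) (auto simp: p_def)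
qed

section \<open>Exterior products with a factor supported on part of the list\<close>

definition vanishes_on :: "('i list \<Rightarrow> 'a::zero) \<Rightarrow> 'i set \<Rightarrow> bool" where
  "vanishes_on f K \<longleftrightarrow> (\<forall>l. set l \<inter> K \<noteq> {} \<longrightarrow> f l = 0)"

lemma contr_vanishes: "vanishes_on f K \<Longrightarrow> x \<in> K \<Longrightarrow> contr x f = (\<lambda>l. 0)"
  by (auto simp: vanishes_on_def contr_def fun_eq_iff)

lemma vanishes_on_contr: "vanishes_on f K \<Longrightarrow> vanishes_on (contr x f) K"
  by (auto simp: vanishes_on_def contr_def)

lemma vanishes_on_twist: "vanishes_on f K \<Longrightarrow> vanishes_on (twist f) K"
  by (auto simp: vanishes_on_def twist_def)

text \<open>All prefix entries must go to \<open>g\<close> and thereby pass the arguments of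
  \<open>f\<close>; this is free of signs because \<open>twist f = f\<close>.\<close>

lemma wedge_prefix:
  assumes "vanishes_on f (set xs)" "twist f = f"
  shows "wedge f g (xs @ l) = wedge f (\<lambda>m. g (xs @ m)) l"
  using assms
proof (induction xs arbitrary: g)
  case (Cons x xs)
  have "vanishes_on f (set xs)" using Cons.prems(1) by (auto simp: vanishes_on_def)
  moreover have "contr x f = (\<lambda>l. 0)" by (rule contr_vanishes[OF Cons.prems(1)]) simp
  ultimately show ?case using Cons.IH[of "contr x g"] Cons.prems(2) by (simp add: contr_def)
qed simp

text \<open>Suffix entries already stand behind every argument of \<open>f\<close>, so handing them
  to \<open>g\<close> costs no sign.\<close>

lemma wedge_suffix:
  assumes "vanishes_on f (set ys)"
  shows "wedge f g (l @ ys) = wedge f (\<lambda>m. g (m @ ys)) l"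
  using assms
proof (induction l arbitrary: f g)
  case Nil
  then show ?case
  proof (induction ys arbitrary: f g)
    case (Cons y ys)
    have "vanishes_on (twist f) (set ys)" using Cons.prems by (auto simp: vanishes_on_def twist_def)
    moreover have "contr y f = (\<lambda>l. 0)" by (rule contr_vanishes[OF Cons.prems]) simp
    ultimately show ?case using Cons.IH[of "twist f" "contr y g"] by (simp add: twist_def contr_def)
  qed simp
next
  case (Cons x l)
  then show ?case
    using Cons.IH[of "contr x f" g] Cons.IH[of "twist f" "contr x g"]
    by (simp add: vanishes_on_contr vanishes_on_twist) (simp add: contr_def)
qed

lemma wedge_map: "wedge f g (map \<phi> xs) = wedge (\<lambda>l. f (map \<phi> l)) (\<lambda>l. g (map \<phi> l)) xs"
  by (induction xs arbitrary: f g) (simp_all add: contr_def twist_def)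

text \<open>An entry in \<open>K\<close> has to be matched with something, and each such pair has
  coefficient zero.\<close>

lemma vanishes_on_pf:
  assumes "\<And>x y. x \<in> K \<or> y \<in> K \<Longrightarrow> d x y = 0"
  shows "vanishes_on (pf d) K"
proof -
  have "set l \<inter> K \<noteq> {} \<Longrightarrow> pf d l = 0" for l
    using assms
  proof (induction d l rule: pf.induct)
    case (2 d x xs)
    have "d x (xs ! i) * pf d (remove_nth i xs) = 0" if i: "i < length xs" for i
    proof (cases "x \<in> K \<or> xs ! i \<in> K")
      case False
      have "xs = take i xs @ xs ! i # drop (Suc i) xs" using i by (rule id_take_nth_drop)
      then have "set xs = insert (xs ! i) (set (remove_nth i xs))"
        unfolding remove_nth_def by (metis list.simps(15) set_append Un_insert_right)
      then have "set (remove_nth i xs) \<inter> K \<noteq> {}" using 2(2) False by auto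
      then have "pf d (remove_nth i xs) = 0" using i 2(3) by (intro 2(1)) auto
      then show ?thesis by simp
    qed (use 2(3) in auto)
    then show ?case by (auto intro!: sum.neutral simp: mult.assoc)
  qed simp
  then show ?thesis by (simp add: vanishes_on_def)
qed

section \<open>Compatibility passes to subtuples\<close>

lemma subseq_strict_mono_index:
  assumes "subseq xs ys"
  shows "\<exists>f. (\<forall>i<length xs. f i < length ys \<and> xs ! i = ys ! f i)
    \<and> (\<forall>i j. i < j \<longrightarrow> j < length xs \<longrightarrow> f i < f j)"
  using assms
proof (induction rule: list_emb.induct)
  case (list_emb_Cons xs ys y)
  then obtain f where "\<forall>i<length xs. f i < length ys \<and> xs ! i = ys ! f i"
    "\<forall>i j. i < j \<longrightarrow> j < length xs \<longrightarrow> f i < f j" by blast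
  then show ?case by (intro exI[of _ "\<lambda>i. Suc (f i)"]) auto
next
  case (list_emb_Cons2 x y xs ys)
  then obtain f where f: "\<forall>i<length xs. f i < length ys \<and> xs ! i = ys ! f i"
    "\<forall>i j. i < j \<longrightarrow> j < length xs \<longrightarrow> f i < f j" by blast
  show ?case
    by (rule exI[of _ "\<lambda>i. case i of 0 \<Rightarrow> 0 | Suc k \<Rightarrow> Suc (f k)"])
      (use f list_emb_Cons2 in \<open>auto simp: less_Suc_eq_0_disj split: nat.split\<close>)
qed simp

lemma D_compatible_subseq:
  assumes "D_compatible D us vs" "subseq us' us" "subseq vs' vs"
  shows "D_compatible D us' vs'"
proof -
  obtain f where f: "\<And>i. i < length us' \<Longrightarrow> f i < length us \<and> us' ! i = us ! f i"
    "\<And>i j. i < j \<Longrightarrow> j < length us' \<Longrightarrow> f i < f j"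
    using subseq_strict_mono_index[OF assms(2)] by blast
  obtain g where g: "\<And>i. i < length vs' \<Longrightarrow> g i < length vs \<and> vs' ! i = vs ! g i"
    "\<And>i j. i < j \<Longrightarrow> j < length vs' \<Longrightarrow> g i < g j"
    using subseq_strict_mono_index[OF assms(3)] by blast
  show ?thesis
    unfolding D_compatible_def
  proof (intro allI impI ballI)
    fix i j k l P Q
    assume *: "i < j" "j < length us'" "k < l" "l < length vs'"
      and P: "P \<in> paths D (us' ! i) (vs' ! l)" and Q: "Q \<in> paths D (us' ! j) (vs' ! k)"
    have eqs: "us' ! i = us ! f i" "us' ! j = us ! f j" "vs' ! k = vs ! g k" "vs' ! l = vs ! g l"
      using f(1) g(1) * by (meson less_trans)+
    show "path_verts D (us' ! i) P \<inter> path_verts D (us' ! j) Q \<noteq> {}"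
      using assms(1)[unfolded D_compatible_def, rule_format, of "f i" "f j" "g k" "g l" P Q]
        f(1)[of j] f(2)[of i j] g(1)[of l] g(2)[of k l] * P Q unfolding eqs by blast
  qed
qed

section \<open>The block matrix as the matrix of one function on tagged vertices\<close>

lemma four_block_vmat:
  "four_block_mat (vmat c X X') (vmat c X Y') (vmat c Y X') (vmat c Y Y') = vmat c (X @ Y) (X' @ Y')"
  by (rule eq_matI) (auto simp: vmat_def nth_append)

lemma index_mult_antidiag:
  fixes X :: "'a::comm_ring_1 mat"
  assumes "i < dim_row X" "j < dim_col X"
  shows "(X * antidiag_mat (dim_col X)) $$ (i, j) = X $$ (i, dim_col X - Suc j)"
proof -
  have "(X * antidiag_mat (dim_col X)) $$ (i, j)
      = (\<Sum>k<dim_col X. X $$ (i, k) * (if Suc (k + j) = dim_col X then 1 else 0))"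
    using assms by (simp add: scalar_prod_def antidiag_mat_def atLeast0LessThan)
  also have "\<dots> = (\<Sum>k<dim_col X. if k = dim_col X - Suc j then X $$ (i, k) else 0)"
    by (rule sum.cong) (use assms in auto)
  finally show ?thesis using assms by simp
qed

lemma index_antidiag_mult:
  fixes X :: "'a::comm_ring_1 mat"
  assumes "i < dim_row X" "j < dim_col X"
  shows "(antidiag_mat (dim_row X) * X) $$ (i, j) = X $$ (dim_row X - Suc i, j)"
proof -
  have "(antidiag_mat (dim_row X) * X) $$ (i, j)
      = (\<Sum>k<dim_row X. (if Suc (i + k) = dim_row X then 1 else 0) * X $$ (k, j))"
    using assms by (simp add: scalar_prod_def antidiag_mat_def atLeast0LessThan)
  also have "\<dots> = (\<Sum>k<dim_row X. if k = dim_row X - Suc i then X $$ (k, j) else 0)"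
    by (rule sum.cong) (use assms in auto)
  finally show ?thesis using assms by simp
qed

definition block_fun ::
  "('u \<Rightarrow> 'u \<Rightarrow> 'a::comm_ring_1) \<Rightarrow> ('u \<Rightarrow> 'v \<Rightarrow> 'a) \<Rightarrow> ('v \<Rightarrow> 'v \<Rightarrow> 'a) \<Rightarrow> 'u + 'v \<Rightarrow> 'u + 'v \<Rightarrow> 'a" where
  "block_fun p g q s t = (case (s, t) of (Inl u, Inl v) \<Rightarrow> p u v | (Inl u, Inr v) \<Rightarrow> g u v
     | (Inr v, Inl u) \<Rightarrow> - g u v | (Inr u, Inr v) \<Rightarrow> q u v)"

lemma block_fun_simps [simp]:
  "block_fun p g q (Inl u) (Inl u') = p u u'" "block_fun p g q (Inl u) (Inr v) = g u v"
  "block_fun p g q (Inr v) (Inl u) = - g u v" "block_fun p g q (Inr v) (Inr v') = q v v'"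
  by (simp_all add: block_fun_def)

text \<open>
  The columns of \<open>S0 @ S\<close> are reversed so that the off-diagonal part contributes plain determinants.
  Reversal multiplies a Pfaffian of size \<open>2k\<close> by \<open>(-1) ^ k\<close>, which the sign of \<open>q\<close> compensates.
\<close>

lemma pf_block_fun:
  fixes a p :: "'u \<Rightarrow> 'u \<Rightarrow> 'a::comm_ring_1" and b q :: "'v \<Rightarrow> 'v \<Rightarrow> 'a" and g :: "'u \<Rightarrow> 'v \<Rightarrow> 'a"
  assumes a: "alternating_fun a" and b: "alternating_fun b"
    and R: "distinct R" and S: "distinct S"
    and inv_a: "\<And>y w. y \<in> set R \<Longrightarrow> w \<in> set R \<Longrightarrow> (\<Sum>z\<in>set R. p y z * a z w) = - of_bool (w = y)"
    and inv_b: "\<And>y w. y \<in> set S \<Longrightarrow> w \<in> set S \<Longrightarrow> (\<Sum>z\<in>set S. q y z * b z w) = - of_bool (w = y)"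
    and p0: "\<And>u v. u \<notin> set R \<or> v \<notin> set R \<Longrightarrow> p u v = 0"
    and q0: "\<And>u v. u \<notin> set S \<or> v \<notin> set S \<Longrightarrow> q u v = 0"
    and disj: "set R \<inter> set R0 = {}" "set S \<inter> set S0 = {}"
  shows "pf a R * (pf b S *
      pf (block_fun p g (\<lambda>u v. - q u v)) (map Inl (R0 @ R) @ map Inr (rev (S0 @ S))))
    = (\<Sum>I\<in>Pow (set R). \<Sum>K\<in>Pow (set S). pf a (subtuple R I) * pf b (subtuple S K) *
        (if length (R0 @ subtuple R I) = length (S0 @ subtuple S K)
         then det (vmat g (R0 @ subtuple R I) (S0 @ subtuple S K)) else 0))"
proof -
  \<comment> \<open>The function is split by support: pairs of rows, pairs of columns, and mixed
    pairs. The first two parts vanish on \<open>R0\<close> and \<open>S0\<close>, so these tuples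
    are always passed on to the mixed part.\<close>
  define dp where "dp = block_fun p (\<lambda>_ _. 0) (\<lambda>(_::'v) (_::'v). 0)"
  define dq where "dq = block_fun (\<lambda>(_::'u) (_::'u). 0) (\<lambda>_ _. 0) (\<lambda>u v. - q u v)"
  have p0': "p u v = 0" if "u \<in> set R0 \<or> v \<in> set R0" for u v using that p0 disj by blast
  have q0': "q u v = 0" if "u \<in> set S0 \<or> v \<in> set S0" for u v using that q0 disj by blast
  let ?o = "pf (bipartite g)"
  let ?G = "\<lambda>m k. ?o (map Inl (R0 @ m) @ map Inr (k @ rev S0))"
  have "block_fun p g (\<lambda>u v. - q u v) = (\<lambda>s t. dp s t + (dq s t + bipartite g s t))"
  proof (intro ext)
    fix s t show "block_fun p g (\<lambda>u v. - q u v) s t = dp s t + (dq s t + bipartite g s t)"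
      by (cases s; cases t) (auto simp: dp_def dq_def)
  qed
  then have "pf (block_fun p g (\<lambda>u v. - q u v)) l = wedge (pf dp) (wedge (pf dq) ?o) l" for l
    by (simp add: pf_add pf_add[abs_def])
  moreover have "wedge (pf dp) F (map Inl (R0 @ R) @ map Inr T)
      = wedge (pf p) (\<lambda>m. F (map Inl (R0 @ m) @ map Inr T)) R" for F T
  proof -
    have "vanishes_on (pf dp) (set (map Inl R0))"
      by (intro vanishes_on_pf) (auto simp: dp_def block_fun_def p0' split: sum.split)
    then have "wedge (pf dp) F (map Inl (R0 @ R) @ map Inr T)
        = wedge (pf dp) (\<lambda>l. F (map Inl R0 @ l)) (map Inl R @ map Inr T)"
      by (simp add: wedge_prefix)
    also have "\<dots> = wedge (pf dp) (\<lambda>l. F (map Inl R0 @ l @ map Inr T)) (map Inl R)"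
    proof -
      have "vanishes_on (pf dp) (set (map Inr T))"
        by (intro vanishes_on_pf) (auto simp: dp_def block_fun_def split: sum.split)
      then show ?thesis by (simp add: wedge_suffix)
    qed
    also have "\<dots> = wedge (pf p) (\<lambda>m. F (map Inl (R0 @ m) @ map Inr T)) R"
      by (simp add: wedge_map pf_map dp_def)
    finally show ?thesis .
  qed
  moreover have "wedge (pf dq) F (map Inl T @ map Inr (rev (S0 @ S)))
      = wedge (pf (\<lambda>u v. - q u v)) (\<lambda>k. F (map Inl T @ map Inr (k @ rev S0))) (rev S)" for F T
  proof -
    have "vanishes_on (pf dq) (set (map Inl T))"
      by (intro vanishes_on_pf) (auto simp: dq_def block_fun_def split: sum.split)
    then have "wedge (pf dq) F (map Inl T @ map Inr (rev (S0 @ S)))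
        = wedge (pf dq) (\<lambda>l. F (map Inl T @ l)) (map Inr (rev S) @ map Inr (rev S0))"
      by (simp add: wedge_prefix)
    also have "\<dots> = wedge (pf dq) (\<lambda>l. F (map Inl T @ l @ map Inr (rev S0))) (map Inr (rev S))"
    proof -
      have "vanishes_on (pf dq) (set (map Inr (rev S0)))"
        by (intro vanishes_on_pf) (auto simp: dq_def block_fun_def q0' split: sum.split)
      then show ?thesis by (simp add: wedge_suffix)
    qed
    also have "\<dots> = wedge (pf (\<lambda>u v. - q u v)) (\<lambda>k. F (map Inl T @ map Inr (k @ rev S0))) (rev S)"
      unfolding wedge_map by (simp add: pf_map dq_def)
    finally show ?thesis .
  qed
  ultimately have "pf (block_fun p g (\<lambda>u v. - q u v)) (map Inl (R0 @ R) @ map Inr (rev (S0 @ S)))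
      = wedge (pf p) (\<lambda>m. wedge (pf (\<lambda>u v. - q u v)) (?G m) (rev S)) R"
    by (simp only:)
  then have "pf b S * pf (block_fun p g (\<lambda>u v. - q u v)) (map Inl (R0 @ R) @ map Inr (rev (S0 @ S)))
      = wedge (pf p) (\<lambda>m. pf b S * wedge (pf (\<lambda>u v. - q u v)) (?G m) (rev S)) R"
    by (simp add: wedge_scale_right)
  also have "(\<lambda>m. pf b S * wedge (pf (\<lambda>u v. - q u v)) (?G m) (rev S))
      = (\<lambda>m. \<Sum>K\<in>Pow (set S). pf b (subtuple S K) * ?G m (rev (subtuple S K)))"
  proof
    fix m
    \<comment> \<open>On the reversed list the pair \<open>- b\<close>, \<open>- q\<close> is used;
      the two signs cancel in the inverse relation, and \<open>pf_rev\<close> returns every Pfaffian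
      of \<open>- b\<close> to one of \<open>b\<close> in the original order.\<close>
    have "alternating_fun (\<lambda>u v. - b u v)"
      using b unfolding alternating_fun_def by (metis minus_zero)
    then have "pf (\<lambda>u v. - b u v) (rev S) * wedge (pf (\<lambda>u v. - q u v)) (?G m) (rev S)
        = (\<Sum>K\<in>Pow (set (rev S)). pf (\<lambda>u v. - b u v) (subtuple (rev S) K) * ?G m (subtuple (rev S) K))"
      using S inv_b by (intro pf_mult_wedge_pf_inverse) auto
    then show "pf b S * wedge (pf (\<lambda>u v. - q u v)) (?G m) (rev S)
      = (\<Sum>K\<in>Pow (set S). pf b (subtuple S K) * ?G m (rev (subtuple S K)))"
      by (simp add: subtuple_def rev_filter[symmetric] pf_rev[OF b])
  qed
  finally have "pf a R * (pf b S *
      pf (block_fun p g (\<lambda>u v. - q u v)) (map Inl (R0 @ R) @ map Inr (rev (S0 @ S))))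
    = pf a R * wedge (pf p) (\<lambda>m. \<Sum>K\<in>Pow (set S). pf b (subtuple S K) * ?G m (rev (subtuple S K))) R"
    by simp
  also have "\<dots> = (\<Sum>I\<in>Pow (set R). pf a (subtuple R I) *
      (\<Sum>K\<in>Pow (set S). pf b (subtuple S K) * ?G (subtuple R I) (rev (subtuple S K))))"
    by (rule pf_mult_wedge_pf_inverse[OF a R inv_a])
  finally have expand: "pf a R * (pf b S *
      pf (block_fun p g (\<lambda>u v. - q u v)) (map Inl (R0 @ R) @ map Inr (rev (S0 @ S))))
    = (\<Sum>I\<in>Pow (set R). pf a (subtuple R I) *
      (\<Sum>K\<in>Pow (set S). pf b (subtuple S K) * ?G (subtuple R I) (rev (subtuple S K))))" .
  have minor: "?G m (rev k) = (if length (R0 @ m) = length (S0 @ k) then det (vmat g (R0 @ m) (S0 @ k)) else 0)"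
    for m k
    using pf_bipartite[of g "R0 @ m" "S0 @ k"] by simp
  show ?thesis by (simp only: expand minor sum_distrib_left mult.assoc)
qed

text \<open>The antidiagonal factors turn into the reversal of the column tuple, and
  \<open>rev (S0 @ S)\<close> is \<open>rev S @ rev S0\<close>, which explains why the blocks of
  \<open>S\<close> precede those of \<open>S0\<close>.\<close>

lemma block_matrix_eq_vmat:
  fixes x :: "'e \<Rightarrow> 'a::field" and p q :: "'v \<Rightarrow> 'v \<Rightarrow> 'a"
  assumes p: "\<And>i j. i < length R \<Longrightarrow> j < length R \<Longrightarrow> 1 / \<alpha> * CA $$ (i, j) = p (R ! i) (R ! j)"
    and q: "\<And>i j. i < length S \<Longrightarrow> j < length S \<Longrightarrow> 1 / \<beta> * CB $$ (i, j) = q (S ! i) (S ! j)"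
    and CA: "CA \<in> carrier_mat (length R) (length R)" and CB: "CB \<in> carrier_mat (length S) (length S)"
    and skew: "\<And>u v. q u v = - q v u"
    and p0: "\<And>u v. u \<notin> set R \<or> v \<notin> set R \<Longrightarrow> p u v = 0"
    and q0: "\<And>u v. u \<notin> set S \<or> v \<notin> set S \<Longrightarrow> q u v = 0"
    and disj: "set R \<inter> set R0 = {}" "set S \<inter> set S0 = {}"
    and len: "length R0 = m" "length S0 = n" "length R = M" "length S = N"
  shows "four_block_mat
         (four_block_mat (0\<^sub>m m m) (0\<^sub>m m M) (0\<^sub>m M m) ((1 / \<alpha>) \<cdot>\<^sub>m CA))
         (four_block_mat
            (z \<cdot>\<^sub>m (H D x R0 S * antidiag_mat N)) (z \<cdot>\<^sub>m (H D x R0 S0 * antidiag_mat n))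
            (z \<cdot>\<^sub>m (H D x R S * antidiag_mat N)) (z \<cdot>\<^sub>m (H D x R S0 * antidiag_mat n)))
         (four_block_mat
            ((- z) \<cdot>\<^sub>m (antidiag_mat N * transpose_mat (H D x R0 S)))
            ((- z) \<cdot>\<^sub>m (antidiag_mat N * transpose_mat (H D x R S)))
            ((- z) \<cdot>\<^sub>m (antidiag_mat n * transpose_mat (H D x R0 S0)))
            ((- z) \<cdot>\<^sub>m (antidiag_mat n * transpose_mat (H D x R S0))))
         (four_block_mat
            ((1 / \<beta>) \<cdot>\<^sub>m (antidiag_mat N * transpose_mat CB * antidiag_mat N)) (0\<^sub>m N n)
            (0\<^sub>m n N) (0\<^sub>m n n))
    = vmat (block_fun p (\<lambda>u v. z * h D x u v) (\<lambda>u v. - q u v))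
        (map Inl (R0 @ R) @ map Inr (rev (S0 @ S))) (map Inl (R0 @ R) @ map Inr (rev (S0 @ S)))"
proof -
  let ?c = "block_fun p (\<lambda>u v. z * h D x u v) (\<lambda>u v. - q u v)"
  have ur: "z \<cdot>\<^sub>m (H D x X Y * antidiag_mat (length Y)) = vmat ?c (map Inl X) (map Inr (rev Y))" for X Y
    using index_mult_antidiag[of _ "H D x X Y"]
    by (intro eq_matI) (auto simp: H_def vmat_def antidiag_mat_def rev_nth)
  have ll: "(- z) \<cdot>\<^sub>m (antidiag_mat (length Y) * transpose_mat (H D x X Y))
      = vmat ?c (map Inr (rev Y)) (map Inl X)" for X Y
    using index_antidiag_mult[of _ "transpose_mat (H D x X Y)"]
    by (intro eq_matI) (auto simp: H_def vmat_def antidiag_mat_def rev_nth)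
  have zero_Inl: "0\<^sub>m (length X) (length Y) = vmat ?c (map Inl X) (map Inl Y)"
    if "\<And>u v. u \<in> set X \<Longrightarrow> v \<in> set Y \<Longrightarrow> p u v = 0" for X Y
    using that by (intro eq_matI) (auto simp: vmat_def)
  have zero_Inr: "0\<^sub>m (length X) (length Y) = vmat ?c (map Inr (rev X)) (map Inr (rev Y))"
    if "\<And>u v. u \<in> set X \<Longrightarrow> v \<in> set Y \<Longrightarrow> q u v = 0" for X Y
    using that by (intro eq_matI) (auto simp: vmat_def rev_nth)
  have ul: "0\<^sub>m m m = vmat ?c (map Inl R0) (map Inl R0)" "0\<^sub>m m M = vmat ?c (map Inl R0) (map Inl R)"
    "0\<^sub>m M m = vmat ?c (map Inl R) (map Inl R0)"
    unfolding len[symmetric] by (rule zero_Inl, use disj p0 in blast)+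
  have lr: "0\<^sub>m n n = vmat ?c (map Inr (rev S0)) (map Inr (rev S0))"
    "0\<^sub>m N n = vmat ?c (map Inr (rev S)) (map Inr (rev S0))"
    "0\<^sub>m n N = vmat ?c (map Inr (rev S0)) (map Inr (rev S))"
    unfolding len[symmetric] by (rule zero_Inr, use disj q0 in blast)+
  have P: "(1 / \<alpha>) \<cdot>\<^sub>m CA = vmat ?c (map Inl R) (map Inl R)"
    using CA p by (intro eq_matI) (auto simp: vmat_def)
  have Q: "(1 / \<beta>) \<cdot>\<^sub>m (antidiag_mat N * transpose_mat CB * antidiag_mat N)
      = vmat ?c (map Inr (rev S)) (map Inr (rev S))"
  proof (rule eq_matI)
    fix i j assume "i < dim_row (vmat ?c (map Inr (rev S)) (map Inr (rev S)))"
      "j < dim_col (vmat ?c (map Inr (rev S)) (map Inr (rev S)))"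
    then have ij: "i < N" "j < N" by (simp_all add: vmat_def len)
    let ?T = "antidiag_mat N * transpose_mat CB"
    have T: "dim_row ?T = N" "dim_col ?T = N" using CB len by (auto simp: antidiag_mat_def)
    have "(?T * antidiag_mat N) $$ (i, j) = ?T $$ (i, N - Suc j)"
      using index_mult_antidiag[of i ?T j] ij unfolding T by blast
    also have "\<dots> = transpose_mat CB $$ (N - Suc i, N - Suc j)"
      using index_antidiag_mult[of i "transpose_mat CB" "N - Suc j"] ij CB len by simp
    also have "\<dots> = CB $$ (N - Suc j, N - Suc i)" using ij CB len by simp
    finally have "1 / \<beta> * (?T * antidiag_mat N) $$ (i, j) = q (S ! (N - Suc j)) (S ! (N - Suc i))"
      using q[of "N - Suc j" "N - Suc i"] ij len by simp
    \<comment> \<open>The transpose of the copfaffian matrix supplies the minus sign that reversing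
      the columns requires.\<close>
    also have "\<dots> = - q (S ! (N - Suc i)) (S ! (N - Suc j))" by (rule skew)
    finally show "((1 / \<beta>) \<cdot>\<^sub>m (?T * antidiag_mat N)) $$ (i, j)
        = vmat ?c (map Inr (rev S)) (map Inr (rev S)) $$ (i, j)"
      using ij T len by (simp add: vmat_def rev_nth antidiag_mat_def)
  qed (use CB len in \<open>auto simp: vmat_def antidiag_mat_def\<close>)
  show ?thesis
    unfolding ul lr P Q ur[of _ S, unfolded len] ur[of _ S0, unfolded len] ll[of S, unfolded len]
      ll[of S0, unfolded len] four_block_vmat by simp
qed

section \<open>Powers of z and regrouping by the number of paths\<close>

lemma det_smult_vmat:
  assumes "length X = length Y"
  shows "det (vmat (\<lambda>u v. z * f u v) X Y) = z ^ length X * det (vmat f X Y)"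
proof -
  have "vmat (\<lambda>u v. z * f u v) X Y = z \<cdot>\<^sub>m vmat f X Y"
    by (intro eq_matI) (auto simp: vmat_def)
  then show ?thesis using assms by (simp add: vmat_def)
qed

lemma length_subtuple: "distinct L \<Longrightarrow> I \<subseteq> set L \<Longrightarrow> length (subtuple L I) = card I"
  using distinct_card[of "subtuple L I"] by (simp add: subtuple_def Int_def inf.absorb_iff2 set_subtuple[unfolded subtuple_def])

text \<open>The parity condition on \<open>r\<close> is automatic on the right, since odd Pfaffians vanish.\<close>

lemma sum_by_size:
  fixes T :: "'u set \<Rightarrow> 'v set \<Rightarrow> 'a::comm_ring_1"
  assumes fin: "finite X" "finite Y" and parity: "even (int m - int n)"
    and odd: "\<And>I K. I \<subseteq> X \<Longrightarrow> K \<subseteq> Y \<Longrightarrow> odd (card I) \<Longrightarrow> T I K = 0"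
  shows "(\<Sum>r | max m n \<le> r \<and> r \<le> min (m + card X) (n + card Y) \<and> even (r - max m n).
        z ^ r * (\<Sum>I | I \<subseteq> X \<and> card I = r - m. \<Sum>K | K \<subseteq> Y \<and> card K = r - n. T I K))
    = (\<Sum>I\<in>Pow X. \<Sum>K\<in>Pow Y. if m + card I = n + card K then z ^ (m + card I) * T I K else 0)"
proof -
  let ?rs = "{r. max m n \<le> r \<and> r \<le> min (m + card X) (n + card Y) \<and> even (r - max m n)}"
  let ?P = "{(I, K). I \<subseteq> X \<and> K \<subseteq> Y \<and> m + card I = n + card K \<and> even (card I)}"
  let ?t = "\<lambda>(I, K). if m + card I = n + card K then z ^ (m + card I) * T I K else 0"
  have finP: "finite ?P"
    by (rule finite_subset[of _ "Pow X \<times> Pow Y"]) (use fin in auto)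
  have size: "(\<lambda>(I, K). m + card I) ` ?P \<subseteq> ?rs"
  proof
    fix r assume "r \<in> (\<lambda>(I, K). m + card I) ` ?P"
    then obtain I K where *: "I \<subseteq> X" "K \<subseteq> Y" "m + card I = n + card K" "even (card I)"
      and r: "r = m + card I" by auto
    have "card I \<le> card X" "card K \<le> card Y" using * fin by (auto intro: card_mono)
    moreover have "even (r - max m n)"
    proof -
      have "even m \<longleftrightarrow> even n" using parity by simp
      moreover from this have "even (card K)" using *(3,4) by (metis even_add)
      ultimately show ?thesis using *(3,4) r by (cases "m \<le> n") (simp_all add: max_def)
    qed
    ultimately show "r \<in> ?rs" using * r by simp
  qed
  have "(\<Sum>I\<in>Pow X. \<Sum>K\<in>Pow Y. if m + card I = n + card K then z ^ (m + card I) * T I K else 0)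
      = sum ?t (Pow X \<times> Pow Y)"
    by (simp add: sum.cartesian_product)
  also have "\<dots> = sum ?t ?P"
    by (rule sum.mono_neutral_right) (use fin odd in \<open>auto split: if_splits intro: ccontr\<close>)
  also have "\<dots> = (\<Sum>r\<in>?rs. sum ?t {IK \<in> ?P. (case IK of (I, K) \<Rightarrow> m + card I) = r})"
    by (rule sum.group[symmetric]) (use finP size in auto)
  also have "\<dots> = (\<Sum>r\<in>?rs.
      z ^ r * (\<Sum>I | I \<subseteq> X \<and> card I = r - m. \<Sum>K | K \<subseteq> Y \<and> card K = r - n. T I K))"
  proof (rule sum.cong)
    fix r assume r: "r \<in> ?rs"
    have "even (r - m)" using r parity by (auto simp: max_def split: if_splits)
    then have "{IK \<in> ?P. (case IK of (I, K) \<Rightarrow> m + card I) = r}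
        = {I. I \<subseteq> X \<and> card I = r - m} \<times> {K. K \<subseteq> Y \<and> card K = r - n}"
      using r by auto
    moreover have "sum ?t ({I. I \<subseteq> X \<and> card I = r - m} \<times> {K. K \<subseteq> Y \<and> card K = r - n})
        = (\<Sum>(I, K)\<in>{I. I \<subseteq> X \<and> card I = r - m} \<times> {K. K \<subseteq> Y \<and> card K = r - n}. z ^ r * T I K)"
      using r by (intro sum.cong) auto
    ultimately show "sum ?t {IK \<in> ?P. (case IK of (I, K) \<Rightarrow> m + card I) = r}
      = z ^ r * (\<Sum>I | I \<subseteq> X \<and> card I = r - m. \<Sum>K | K \<subseteq> Y \<and> card K = r - n. T I K)"
      by (simp add: sum.cartesian_product[symmetric] sum_distrib_left)
  qed simp
  finally show ?thesis ..
qed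

theorem theorem4p6:
  fixes D :: "('v, 'e) pre_digraph"
    and x :: "'e \<Rightarrow> 'a::field"
    and z :: 'a
    and a b :: "'v \<Rightarrow> 'v \<Rightarrow> 'a"
    and R0 S0 R S :: "'v list"
    and m n M N :: nat
  defines "A \<equiv> vmat a R R"
    and "B \<equiv> vmat b S S"
    and "J \<equiv> (antidiag_mat :: nat \<Rightarrow> 'a mat)"
  assumes "acyclic_digraph D"
    and "finitely_many_paths D"
    and "even M" and "even N" and "even (int m - int n)"
    and "length R0 = m" and "length S0 = n" and "length R = M" and "length S = N"
    and "set R0 \<subseteq> verts D" and "set S0 \<subseteq> verts D"
    and "set R \<subseteq> verts D" and "set S \<subseteq> verts D"
    and "distinct R" and "distinct S"
    and "set R \<inter> set R0 = {}" and "set S \<inter> set S0 = {}"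
    and "D_compatible D (R0 @ R) (S0 @ S)"
    and "skew_symmetric_mat A" and "invertible_mat A"
    and "skew_symmetric_mat B" and "invertible_mat B"
  shows
    "(\<Sum>r | max m n \<le> r \<and> r \<le> min (m + M) (n + N) \<and> even (r - max m n).
        z ^ r *
        (\<Sum>I | I \<subseteq> set R \<and> card I = r - m. \<Sum>K | K \<subseteq> set S \<and> card K = r - n.
           Pf (vmat a (subtuple R I) (subtuple R I)) *
           Pf (vmat b (subtuple S K) (subtuple S K)) *
           F0 D x (R0 @ subtuple R I) (S0 @ subtuple S K)))
     = Pf A * Pf B *
       Pf (four_block_mat
         (four_block_mat
            (0\<^sub>m m m) (0\<^sub>m m M)
            (0\<^sub>m M m) ((1 / Pf A) \<cdot>\<^sub>m copfaffian A))
         (four_block_mat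
            (z \<cdot>\<^sub>m (H D x R0 S * J N)) (z \<cdot>\<^sub>m (H D x R0 S0 * J n))
            (z \<cdot>\<^sub>m (H D x R S * J N)) (z \<cdot>\<^sub>m (H D x R S0 * J n)))
         (four_block_mat
            ((- z) \<cdot>\<^sub>m (J N * transpose_mat (H D x R0 S)))
            ((- z) \<cdot>\<^sub>m (J N * transpose_mat (H D x R S)))
            ((- z) \<cdot>\<^sub>m (J n * transpose_mat (H D x R0 S0)))
            ((- z) \<cdot>\<^sub>m (J n * transpose_mat (H D x R S0))))
         (four_block_mat
            ((1 / Pf B) \<cdot>\<^sub>m (J N * transpose_mat (copfaffian B) * J N)) (0\<^sub>m N n)
            (0\<^sub>m n N) (0\<^sub>m n n)))"
proof -
  note R = \<open>distinct R\<close> and S = \<open>distinct S\<close>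
  note evens = \<open>even M\<close> \<open>even N\<close> \<open>even (int m - int n)\<close>
  note len = \<open>length R0 = m\<close> \<open>length S0 = n\<close> \<open>length R = M\<close> \<open>length S = N\<close>
  note disj = \<open>set R \<inter> set R0 = {}\<close> \<open>set S \<inter> set S0 = {}\<close>
  define a' where "a' = restrict_to (set R) a"
  define b' where "b' = restrict_to (set S) b"
  have A: "A = vmat a' R R" and B: "B = vmat b' S S"
    by (simp_all add: A_def B_def a'_def b'_def vmat_restrict_to)
  have alt_a: "alternating_fun a'" and alt_b: "alternating_fun b'"
    using \<open>skew_symmetric_mat A\<close> \<open>skew_symmetric_mat B\<close> unfolding A_def B_def a'_def b'_def
    by (simp_all add: alternating_fun_restrict_to)
  obtain p where p: "\<And>y w. y \<in> set R \<Longrightarrow> w \<in> set R \<Longrightarrow> (\<Sum>z\<in>set R. p y z * a' z w) = - of_bool (w = y)"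
    and p0: "\<And>u v. u \<notin> set R \<or> v \<notin> set R \<Longrightarrow> p u v = 0"
    using ex_inverse_function[OF R \<open>invertible_mat A\<close>[unfolded A]] by metis
  obtain q where q: "\<And>y w. y \<in> set S \<Longrightarrow> w \<in> set S \<Longrightarrow> (\<Sum>z\<in>set S. q y z * b' z w) = - of_bool (w = y)"
    and q0: "\<And>u v. u \<notin> set S \<or> v \<notin> set S \<Longrightarrow> q u v = 0"
    using ex_inverse_function[OF S \<open>invertible_mat B\<close>[unfolded B]] by metis
  have Pf_A: "Pf A = pf a' R" and Pf_B: "Pf B = pf b' S"
    using evens len by (simp_all add: A B Pf_vmat)
  \<comment> \<open>Skew-symmetry of \<open>q\<close> is first known only after multiplication by
    this Pfaffian, which is now cancelled.\<close>
  have "pf b' S \<noteq> 0" using pf_mult_pf_inverse[OF alt_b S q] by auto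
  then have skew: "q u v = - q v u" for u v
    using pf_inverse_alternating(1)[OF alt_b q, of u v] q0[of u v] q0[of v u]
    by (cases "u \<in> set S \<and> v \<in> set S")
      (auto simp: mult_minus_left[symmetric] simp del: mult_minus_left)
  let ?W = "map Inl (R0 @ R) @ map Inr (rev (S0 @ S)) :: ('v + 'v) list"
  let ?c = "block_fun p (\<lambda>u v. z * h D x u v) (\<lambda>u v. - q u v)"
  let ?T = "\<lambda>I K. pf a' (subtuple R I) * pf b' (subtuple S K) *
    F0 D x (R0 @ subtuple R I) (S0 @ subtuple S K)"
  have lgv: "det (vmat (\<lambda>u v. z * h D x u v) (R0 @ subtuple R I) (S0 @ subtuple S K))
      = z ^ (m + card I) * F0 D x (R0 @ subtuple R I) (S0 @ subtuple S K)"
    if I: "I \<subseteq> set R" and K: "K \<subseteq> set S" and eq: "m + card I = n + card K" for I K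
  proof -
    have l: "length (S0 @ subtuple S K) = length (R0 @ subtuple R I)" "length (R0 @ subtuple R I) = m + card I"
      using eq len by (simp_all add: length_subtuple[OF R I] length_subtuple[OF S K])
    have "D_compatible D (R0 @ subtuple R I) (S0 @ subtuple S K)"
      by (rule D_compatible_subseq[OF \<open>D_compatible D (R0 @ R) (S0 @ S)\<close>])
        (auto simp: subtuple_def intro: list_emb_append_mono)
    then have "det (H D x (R0 @ subtuple R I) (S0 @ subtuple S K))
        = F0 D x (R0 @ subtuple R I) (S0 @ subtuple S K)"
      using assms(4,5,13-16) l
      by (intro lindstroem_gessel_viennot acyclic_digraph_imp_acyclic_wf) (auto simp: set_subtuple)
    then show ?thesis
      using det_smult_vmat[OF l(1)[symmetric], of z "h D x"] unfolding H_def l(2) by simp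
  qed
  have Pf_sub: "Pf (vmat f (subtuple L I) (subtuple L I)) = pf (restrict_to (set L) f) (subtuple L I)"
    if "distinct L" "I \<subseteq> set L" "even (card I)" for f :: "'v \<Rightarrow> 'v \<Rightarrow> 'a" and L I
    using Pf_vmat[of "subtuple L I" "restrict_to (set L) f"] that
    by (simp add: length_subtuple vmat_restrict_to set_subtuple)
  have "(\<Sum>r | max m n \<le> r \<and> r \<le> min (m + M) (n + N) \<and> even (r - max m n).
        z ^ r *
        (\<Sum>I | I \<subseteq> set R \<and> card I = r - m. \<Sum>K | K \<subseteq> set S \<and> card K = r - n.
           Pf (vmat a (subtuple R I) (subtuple R I)) *
           Pf (vmat b (subtuple S K) (subtuple S K)) *
           F0 D x (R0 @ subtuple R I) (S0 @ subtuple S K)))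
    = (\<Sum>r | max m n \<le> r \<and> r \<le> min (m + M) (n + N) \<and> even (r - max m n).
        z ^ r * (\<Sum>I | I \<subseteq> set R \<and> card I = r - m. \<Sum>K | K \<subseteq> set S \<and> card K = r - n. ?T I K))"
  proof (intro sum.cong refl arg_cong2[where f = "(*)"])
    fix r I K assume "r \<in> {r. max m n \<le> r \<and> r \<le> min (m + M) (n + N) \<and> even (r - max m n)}"
      and I: "I \<in> {I. I \<subseteq> set R \<and> card I = r - m}" and K: "K \<in> {K. K \<subseteq> set S \<and> card K = r - n}"
    \<comment> \<open>Both differences are even because \<open>m\<close> and \<open>n\<close> have
      the same parity. This is needed since \<open>Pf\<close> is identified with \<open>pf\<close>
      in even size only.\<close>
    then have "even (r - m)" "even (r - n)"
      using evens(3) by (auto simp: max_def split: if_splits)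
    then show "Pf (vmat a (subtuple R I) (subtuple R I)) = pf a' (subtuple R I)"
      "Pf (vmat b (subtuple S K) (subtuple S K)) = pf b' (subtuple S K)"
      using I K R S by (auto simp: a'_def b'_def Pf_sub)
  qed
  also have "\<dots> = (\<Sum>I\<in>Pow (set R). \<Sum>K\<in>Pow (set S).
      if m + card I = n + card K then z ^ (m + card I) * ?T I K else 0)"
  proof -
    \<comment> \<open>It is enough to discard odd \<open>I\<close>: when
      \<open>m + card I = n + card K\<close>, the set \<open>K\<close> has the same parity as
      \<open>I\<close>.\<close>
    have "?T I K = 0" if "I \<subseteq> set R" "odd (card I)" for I K
      using that by (simp add: pf_odd length_subtuple[OF R])
    moreover have "card (set R) = M" "card (set S) = N" using R S len by (simp_all add: distinct_card)
    ultimately show ?thesis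
      using sum_by_size[of "set R" "set S" m n ?T z] evens(3) by simp
  qed
  also have "\<dots> = (\<Sum>I\<in>Pow (set R). \<Sum>K\<in>Pow (set S). pf a' (subtuple R I) * pf b' (subtuple S K) *
        (if length (R0 @ subtuple R I) = length (S0 @ subtuple S K)
         then det (vmat (\<lambda>u v. z * h D x u v) (R0 @ subtuple R I) (S0 @ subtuple S K)) else 0))"
    by (intro sum.cong refl)
      (use len in \<open>auto simp: length_subtuple R S lgv simp del: append_assoc\<close>)
  also have "\<dots> = pf a' R * (pf b' S * pf ?c ?W)"
    by (rule pf_block_fun[OF alt_a alt_b R S p q p0 q0 disj, symmetric])
  also have "pf ?c ?W = Pf (vmat ?c ?W ?W)"
    using evens len by (intro Pf_vmat[symmetric]) simp
  also have "pf a' R * (pf b' S * Pf (vmat ?c ?W ?W)) = Pf A * Pf B * Pf (vmat ?c ?W ?W)"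
    by (simp add: Pf_A Pf_B mult.assoc)
  finally have sum_eq: "(\<Sum>r | max m n \<le> r \<and> r \<le> min (m + M) (n + N) \<and> even (r - max m n).
        z ^ r *
        (\<Sum>I | I \<subseteq> set R \<and> card I = r - m. \<Sum>K | K \<subseteq> set S \<and> card K = r - n.
           Pf (vmat a (subtuple R I) (subtuple R I)) *
           Pf (vmat b (subtuple S K) (subtuple S K)) *
           F0 D x (R0 @ subtuple R I) (S0 @ subtuple S K)))
    = Pf A * Pf B * Pf (vmat ?c ?W ?W)" .
  have PA: "1 / Pf A * copfaffian A $$ (i, j) = p (R ! i) (R ! j)" if "i < length R" "j < length R" for i j
    using copfaffian_eq_inverse[OF alt_a R _ p that] evens len unfolding Pf_A by (simp add: A)
  have PB: "1 / Pf B * copfaffian B $$ (i, j) = q (S ! i) (S ! j)" if "i < length S" "j < length S" for i j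
    using copfaffian_eq_inverse[OF alt_b S _ q that] evens len unfolding Pf_B by (simp add: B)
  have carrier: "copfaffian A \<in> carrier_mat (length R) (length R)"
    "copfaffian B \<in> carrier_mat (length S) (length S)"
    by (simp_all add: A B copfaffian_def vmat_def)
  show ?thesis
    unfolding sum_eq J_def
    by (subst block_matrix_eq_vmat[where p = p and q = q, OF PA PB carrier skew p0 q0 disj len])
      (assumption | rule refl)+
qed

end
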